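(* Let $m\in\mathbb N$ and let $I:(0,1]\to(0,\infty)$ be nondecreasing with $\inf_{t\in(0,1]}I(t)/t>0$. Let $\|\cdot\|_{X(0,1)}$ be a rearrangement-invariant norm with fundamental function $\varphi_X$. (a) The following are equivalent: (i) $\lim_{a\to0_+}\sup_{\|f\|_{L^1(0,1)}\le1}\|H^m_I(\chi_{(0,a)}f)\|_{X(0,1)}=0$; (ii) $\lim_{a\to0_+}\sup_{\|f\|_{L^1(0,1)}\le1}\|K^m_I(\chi_{(0,a)}f)\|_{X(0,1)}=0$; (iii) $\lim_{a\to0_+}\frac{a^{m-1}\varphi_X(a)}{(I(a))^m}=0$. (b) The following are equivalent: (i) $\lim_{a\to0_+}\sup_{\|f\|_{X(0,1)}\le1}\|H^m_I(\chi_{(0,a)}f)\|_{L^1(0,1)}=0$; (ii) $\lim_{a\to0_+}\sup_{\|f\|_{X(0,1)}\le1}\|K^m_I(\chi_{(0,a)}f)\|_{L^1(0,1)}=0$. If $X(0,1)\ne L^1(0,1)$, then both (i) and (ii) hold; if $X(0,1)=L^1(0,1)$, then (i) and (ii) hold if and only if $\lim_{s\to0_+}\frac{s}{I(s)}=0$.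
   Context: A rearrangement-invariant (r.i.) norm on $(0,1)$ is a functional $\|\cdot\|_{X(0,1)}$ on measurable functions with values in $[0,\infty]$ satisfying: for $f,g\ge0$, $a\ge0$, $\|f\|=0$ iff $f=0$ a.e., $\|af\|=a\|f\|$, $\|f+g\|\le\|f\|+\|g\|$; $f\le g$ a.e. $\Rightarrow\|f\|\le\|g\|$; $0\le f_k\uparrow f$ a.e. $\Rightarrow\|f_k\|\uparrow\|f\|$; $\|1\|<\infty$; $\int_0^1f\le C\|f\|$; equimeasurable functions have equal norm. Its fundamental function is $\varphi_X(t)=\|\chi_{(0,t)}\|_{X(0,1)}$. $X(0,1)=L^1(0,1)$ means equality as sets. Operators: $H^m_If(t)=\frac{1}{(m-1)!}\int_t^1\frac{|f(s)|}{I(s)}\big(\int_t^s\frac{dr}{I(r)}\big)^{m-1}ds$ and $K^m_If(t)=\int_t^1|f(s)|\frac{s^{m-1}}{(I(s))^m}ds$, $t\in(0,1)$. *)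

theory Defs
  imports "HOL-Analysis.Analysis"
begin

text \<open>Rearrangement-invariant norms on (0,1).  A norm is modelled as a functional
  X acting on nonnegative, possibly infinite, Lebesgue measurable functions
  (values in [0,\<infinity>] = ennreal); only values on (0,1) matter.  The norm of a
  real function f is X applied to |f|.\<close>

definition ri_norm :: "((real \<Rightarrow> ennreal) \<Rightarrow> ennreal) \<Rightarrow> bool" where
  "ri_norm X \<longleftrightarrow>
     (\<forall>f \<in> borel_measurable lebesgue.
        X f = 0 \<longleftrightarrow> (AE t in lebesgue. t \<in> {0<..<1} \<longrightarrow> f t = 0)) \<and>
     (\<forall>f \<in> borel_measurable lebesgue. \<forall>a::real. a \<ge> 0 \<longrightarrow>
        X (\<lambda>t. ennreal a * f t) = ennreal a * X f) \<and>
     (\<forall>f \<in> borel_measurable lebesgue. \<forall>g \<in> borel_measurable lebesgue.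
        X (\<lambda>t. f t + g t) \<le> X f + X g) \<and>
     (\<forall>f \<in> borel_measurable lebesgue. \<forall>g \<in> borel_measurable lebesgue.
        (AE t in lebesgue. t \<in> {0<..<1} \<longrightarrow> f t \<le> g t) \<longrightarrow> X f \<le> X g) \<and>
     (\<forall>F f. (\<forall>k. F k \<in> borel_measurable lebesgue) \<longrightarrow> f \<in> borel_measurable lebesgue \<longrightarrow>
        (AE t in lebesgue. t \<in> {0<..<1} \<longrightarrow>
            incseq (\<lambda>k. F k t) \<and> (\<lambda>k. F k t) \<longlonglongrightarrow> f t) \<longrightarrow>
        incseq (\<lambda>k. X (F k)) \<and> (\<lambda>k. X (F k)) \<longlonglongrightarrow> X f) \<and>
     X (\<lambda>_. 1) < \<infinity> \<and>
     (\<exists>C::real. \<forall>f \<in> borel_measurable lebesgue.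
        (\<integral>\<^sup>+ t. f t * indicator {0<..<1} t \<partial>lebesgue) \<le> ennreal C * X f) \<and>
     (\<forall>f \<in> borel_measurable lebesgue. \<forall>g \<in> borel_measurable lebesgue.
        (\<forall>c::ennreal. emeasure lebesgue {t \<in> {0<..<1}. f t > c}
                      = emeasure lebesgue {t \<in> {0<..<1}. g t > c}) \<longrightarrow> X f = X g)"

definition fund_fun :: "((real \<Rightarrow> ennreal) \<Rightarrow> ennreal) \<Rightarrow> real \<Rightarrow> ennreal" where
  "fund_fun X t = X (\<lambda>s. indicator {0<..<t} s)"

definition rnorm :: "((real \<Rightarrow> ennreal) \<Rightarrow> ennreal) \<Rightarrow> (real \<Rightarrow> real) \<Rightarrow> ennreal" where
  "rnorm X f = X (\<lambda>t. ennreal \<bar>f t\<bar>)"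

definition L1norm :: "(real \<Rightarrow> ennreal) \<Rightarrow> ennreal" where
  "L1norm g = (\<integral>\<^sup>+ t. g t * indicator {0<..<1} t \<partial>lebesgue)"

definition Xspace :: "((real \<Rightarrow> ennreal) \<Rightarrow> ennreal) \<Rightarrow> (real \<Rightarrow> real) set" where
  "Xspace X = {f \<in> borel_measurable lebesgue. rnorm X f < \<infinity>}"

definition L1space :: "(real \<Rightarrow> real) set" where
  "L1space = {f \<in> borel_measurable lebesgue. L1norm (\<lambda>t. ennreal \<bar>f t\<bar>) < \<infinity>}"

definition chi :: "real \<Rightarrow> (real \<Rightarrow> real) \<Rightarrow> real \<Rightarrow> real" where
  "chi a f = (\<lambda>s. indicator {0<..<a} s * f s)"

definition HI :: "nat \<Rightarrow> (real \<Rightarrow> real) \<Rightarrow> (real \<Rightarrow> real) \<Rightarrow> real \<Rightarrow> ennreal" where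
  "HI m I f t = ennreal (1 / fact (m - 1)) *
     (\<integral>\<^sup>+ s. ennreal (\<bar>f s\<bar> / I s) *
        (\<integral>\<^sup>+ r. ennreal (1 / I r) * indicator {t<..<s} r \<partial>lebesgue) ^ (m - 1)
        * indicator {t<..<1} s \<partial>lebesgue)"

definition KI :: "nat \<Rightarrow> (real \<Rightarrow> real) \<Rightarrow> (real \<Rightarrow> real) \<Rightarrow> real \<Rightarrow> ennreal" where
  "KI m I f t = (\<integral>\<^sup>+ s. ennreal (\<bar>f s\<bar> * s ^ (m - 1) / (I s) ^ m)
        * indicator {t<..<1} s \<partial>lebesgue)"

end

theory Submission
  imports Defs
begin

text \<open>
  Both operators are treated at once, through two estimates they share. Let \<open>\<rho> s\<close> denote the
  \<open>m\<close>-th root of \<open>s\<close>. If \<open>1/I r \<le> d \<rho>(r) / (r \<psi>(r))\<close> for an increasing \<open>\<psi>\<close>, then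
  \<open>T f t \<le> C d^(m-1) \<psi>(t)^(1-m) \<integral>\<^sub>t |f s| s / (\<rho>(s) I(s)) ds\<close>; conversely \<open>T\<close> of a multiple \<open>g\<close> of the
  indicator of \<open>(a/2, a)\<close> is at least \<open>c g a^m / I(a)^m\<close> on \<open>(0, a/4)\<close>.

  For (a), take \<open>\<psi>^m\<close> to be the fundamental function: then the hypothesis on \<open>\<psi>\<close> is a bound on
  \<open>a^(m-1) \<phi>(a) / I(a)^m\<close>, and cutting \<open>(0, a)\<close> along dyadic levels of \<open>\<psi>\<close> gives
  \<open>\<parallel>\<psi>(t)^(1-m) \<integral>\<^sub>t h/\<psi>\<parallel> \<le> 2^(m+1) \<integral> h\<close> from countable subadditivity alone, without Minkowski's integral
  inequality or duality. For (b), the same estimate in \<open>L\<^sup>1\<close> with \<open>\<psi> = \<rho>\<close> bounds \<open>\<parallel>T f\<parallel>\<close> by the integral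
  of \<open>|f s| s / I(s)\<close>. Finally \<open>X = L\<^sup>1\<close> holds iff \<open>\<phi>(a) = O(a)\<close>, and averaging cyclic shifts of the
  decreasing rearrangement shows that the integral of \<open>|f|\<close> over \<open>(0, a)\<close> is at most \<open>a / \<phi>(a)\<close> on the
  unit ball of \<open>X\<close>.
\<close>

section \<open>Rearrangement-invariant norms\<close>

lemma AE_lebesgue_neq: "AE t in lebesgue. t \<noteq> (b::real)"
  by (rule AE_completion[OF AE_lborel_singleton])

lemma borel_interval:
  fixes A :: "real set"
  assumes "is_interval A"
  shows "A \<in> sets borel"
  using is_real_interval[OF assms] by (elim exE disjE) simp_all

lemma sets_lebesgue_interval:
  fixes A :: "real set"
  assumes "is_interval A"
  shows "A \<in> sets lebesgue"
  using borel_interval[OF assms] by (simp add: sets_completionI_sets)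

text \<open>Superlevel sets of a decreasing function are intervals. This yields measurability of
  \<open>rearr f\<close> and of the operators without any condition on \<open>f\<close>.\<close>

lemma borel_measurable_antimono:
  fixes f :: "real \<Rightarrow> ennreal"
  assumes "antimono f"
  shows "f \<in> borel_measurable borel"
proof (rule borel_measurableI_greater)
  fix c
  have "is_interval {x. c < f x}"
    unfolding is_interval_1 using assms by (fastforce simp: antimono_def)
  then show "{x \<in> space borel. c < f x} \<in> sets borel"
    by (simp add: borel_interval)
qed

lemma indicator_Ioo_measurable[simp, measurable]:
  "indicator {a<..<b::real} \<in> borel_measurable lebesgue"
  by (intro borel_measurable_indicator) simp

text \<open>The minimum makes the induction close. If \<open>y < z\<close>, the remaining terms
  start from \<open>y / 2\<close> and contribute at most \<open>y\<close>, giving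
  \<open>2 * y\<close>; otherwise the first term drops out and \<open>2 * min (y / 2) z\<close> is
  at most \<open>2 * z\<close>. A bound by \<open>2 * z\<close> alone would not absorb the first
  term.\<close>

lemma sum_dyadic_le:
  assumes "0 < y" "0 < z"
  shows "(\<Sum>k<n. y / 2 ^ k * of_bool (y / 2 ^ k < z)) \<le> (2 * min y z :: real)"
  using assms(1)
proof (induction n arbitrary: y)
  case 0
  then show ?case using assms(2) by simp
next
  case (Suc n)
  have "(\<Sum>k<Suc n. y / 2 ^ k * of_bool (y / 2 ^ k < z))
      = y * of_bool (y < z) + (\<Sum>k<n. (y / 2) / 2 ^ k * of_bool ((y / 2) / 2 ^ k < z))"
    by (subst sum.lessThan_Suc_shift) (simp add: field_simps)
  also have "\<dots> \<le> y * of_bool (y < z) + 2 * min (y / 2) z"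
    using Suc.IH[of "y / 2"] Suc.prems by simp
  also have "\<dots> \<le> 2 * min y z"
    using Suc.prems by (auto simp: min_def)
  finally show ?case .
qed

lemma suminf_dyadic_le:
  assumes "0 < y" "0 < z"
  shows "(\<Sum>k. ennreal (y / 2 ^ k * of_bool (y / 2 ^ k < z))) \<le> ennreal (2 * z)"
proof (rule suminf_le_const)
  fix n
  have "(\<Sum>k<n. ennreal (y / 2 ^ k * of_bool (y / 2 ^ k < z)))
      = ennreal (\<Sum>k<n. y / 2 ^ k * of_bool (y / 2 ^ k < z))"
    using assms by (intro sum_ennreal) auto
  also have "\<dots> \<le> ennreal (2 * z)"
    using sum_dyadic_le[OF assms, of n] by (intro ennreal_leI) auto
  finally show "(\<Sum>k<n. ennreal (y / 2 ^ k * of_bool (y / 2 ^ k < z))) \<le> ennreal (2 * z)" .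
qed auto

section \<open>The axioms of a rearrangement-invariant norm as separate rules, and countable
  subadditivity\<close>

locale ri =
  fixes X :: "(real \<Rightarrow> ennreal) \<Rightarrow> ennreal"
  assumes ri: "ri_norm X"
begin

lemma eq_0_iff:
  "f \<in> borel_measurable lebesgue \<Longrightarrow> X f = 0 \<longleftrightarrow> (AE t in lebesgue. t \<in> {0<..<1} \<longrightarrow> f t = 0)"
  using ri unfolding ri_norm_def by blast

lemma cmult:
  "f \<in> borel_measurable lebesgue \<Longrightarrow> c < \<infinity> \<Longrightarrow> X (\<lambda>t. c * f t) = c * X f"
proof -
  assume f: "f \<in> borel_measurable lebesgue" and c: "c < \<infinity>"
  have "\<forall>f \<in> borel_measurable lebesgue. \<forall>a::real. a \<ge> 0 \<longrightarrow>
        X (\<lambda>t. ennreal a * f t) = ennreal a * X f"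
    using ri unfolding ri_norm_def by blast
  with f c show ?thesis by (cases c) auto
qed

lemma add_le:
  "f \<in> borel_measurable lebesgue \<Longrightarrow> g \<in> borel_measurable lebesgue
    \<Longrightarrow> X (\<lambda>t. f t + g t) \<le> X f + X g"
  using ri unfolding ri_norm_def by blast

lemma mono_AE:
  "f \<in> borel_measurable lebesgue \<Longrightarrow> g \<in> borel_measurable lebesgue
    \<Longrightarrow> (AE t in lebesgue. t \<in> {0<..<1} \<longrightarrow> f t \<le> g t) \<Longrightarrow> X f \<le> X g"
  using ri unfolding ri_norm_def by blast

lemma mono:
  "f \<in> borel_measurable lebesgue \<Longrightarrow> g \<in> borel_measurable lebesgue
    \<Longrightarrow> (\<And>t. 0 < t \<Longrightarrow> t < 1 \<Longrightarrow> f t \<le> g t) \<Longrightarrow> X f \<le> X g"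
  by (rule mono_AE) auto

lemma Fatou:
  assumes "\<And>k. F k \<in> borel_measurable lebesgue" "f \<in> borel_measurable lebesgue"
    "AE t in lebesgue. t \<in> {0<..<1} \<longrightarrow> incseq (\<lambda>k. F k t) \<and> (\<lambda>k. F k t) \<longlonglongrightarrow> f t"
  shows "(\<lambda>k. X (F k)) \<longlonglongrightarrow> X f"
proof -
  have "\<forall>F f. (\<forall>k. F k \<in> borel_measurable lebesgue) \<longrightarrow> f \<in> borel_measurable lebesgue \<longrightarrow>
        (AE t in lebesgue. t \<in> {0<..<1} \<longrightarrow>
            incseq (\<lambda>k. F k t) \<and> (\<lambda>k. F k t) \<longlonglongrightarrow> f t) \<longrightarrow>
        incseq (\<lambda>k. X (F k)) \<and> (\<lambda>k. X (F k)) \<longlonglongrightarrow> X f"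
    using ri unfolding ri_norm_def by blast
  with assms show ?thesis by blast
qed

lemma one_finite: "X (\<lambda>_. 1) < \<infinity>"
  using ri unfolding ri_norm_def by blast

lemma L1norm_le: obtains C where "0 < C" "\<And>f. f \<in> borel_measurable lebesgue \<Longrightarrow> L1norm f \<le> ennreal C * X f"
proof -
  have "\<exists>C::real. \<forall>f \<in> borel_measurable lebesgue.
        (\<integral>\<^sup>+ t. f t * indicator {0<..<1} t \<partial>lebesgue) \<le> ennreal C * X f"
    using ri unfolding ri_norm_def by blast
  then obtain C where C: "\<And>f. f \<in> borel_measurable lebesgue \<Longrightarrow> L1norm f \<le> ennreal C * X f"
    unfolding L1norm_def by blast
  \<comment> \<open>Passing to \<open>max C 1\<close> makes the constant positive, so that it can
    later be divided by.\<close>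
  have "L1norm f \<le> ennreal (max C 1) * X f" if "f \<in> borel_measurable lebesgue" for f
    using C[OF that] by (rule order_trans) (intro mult_right_mono ennreal_leI, auto)
  then show ?thesis by (intro that[of "max C 1"]) auto
qed

lemma equimeasurable:
  assumes "f \<in> borel_measurable lebesgue" "g \<in> borel_measurable lebesgue"
    "\<And>c. emeasure lebesgue {t \<in> {0<..<1}. f t > c} = emeasure lebesgue {t \<in> {0<..<1}. g t > c}"
  shows "X f = X g"
proof -
  have "\<forall>f \<in> borel_measurable lebesgue. \<forall>g \<in> borel_measurable lebesgue.
        (\<forall>c::ennreal. emeasure lebesgue {t \<in> {0<..<1}. f t > c}
                      = emeasure lebesgue {t \<in> {0<..<1}. g t > c}) \<longrightarrow> X f = X g"
    using ri unfolding ri_norm_def by blast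
  with assms show ?thesis by blast
qed

lemma X_zero: "X (\<lambda>_. 0) = 0"
  by (subst eq_0_iff) auto

lemma sum_le:
  assumes "\<And>k. F k \<in> borel_measurable lebesgue"
  shows "X (\<lambda>t. \<Sum>k<(n::nat). F k t) \<le> (\<Sum>k<n. X (F k))"
proof (induction n)
  case 0
  then show ?case by (simp add: X_zero)
next
  case (Suc n)
  have "X (\<lambda>t. \<Sum>k<Suc n. F k t) \<le> X (\<lambda>t. \<Sum>k<n. F k t) + X (F n)"
    using add_le[of "\<lambda>t. \<Sum>k<n. F k t" "F n"] assms by simp
  also have "\<dots> \<le> (\<Sum>k<Suc n. X (F k))"
    using Suc by (simp add: add_right_mono)
  finally show ?case .
qed

text \<open>The partial sums increase to the series, so finite subadditivity passes to the limit by
  the Fatou property.\<close>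

lemma suminf_le:
  assumes [measurable]: "\<And>k. F k \<in> borel_measurable lebesgue"
  shows "X (\<lambda>t. \<Sum>k. F k t) \<le> (\<Sum>k. X (F k))"
proof -
  have "(\<lambda>n. X (\<lambda>t. \<Sum>k<n. F k t)) \<longlonglongrightarrow> X (\<lambda>t. \<Sum>k. F k t)"
  proof (rule Fatou)
    show "AE t in lebesgue. t \<in> {0<..<1} \<longrightarrow> incseq (\<lambda>k. \<Sum>k<k. F k t) \<and>
        (\<lambda>k. \<Sum>k<k. F k t) \<longlonglongrightarrow> (\<Sum>k. F k t)"
      by (intro AE_I2 impI conjI incseq_SucI summable_LIMSEQ) auto
  qed auto
  then show ?thesis
  proof (rule LIMSEQ_le_const2)
    have "X (\<lambda>t. \<Sum>k<n. F k t) \<le> (\<Sum>k. X (F k))" for n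
      by (rule order_trans[OF sum_le sum_le_suminf]) auto
    then show "\<exists>N. \<forall>n\<ge>N. X (\<lambda>t. \<Sum>k<n. F k t) \<le> (\<Sum>k. X (F k))" by blast
  qed
qed

section \<open>The fundamental function and its sublevel sets\<close>

lemma fund_fun_mono: "s \<le> t \<Longrightarrow> fund_fun X s \<le> fund_fun X t"
  unfolding fund_fun_def by (rule mono) (auto split: split_indicator)

lemma fund_fun_finite: "fund_fun X t < \<infinity>"
proof -
  have "fund_fun X t \<le> X (\<lambda>_. 1)"
    unfolding fund_fun_def by (rule mono) (auto split: split_indicator)
  then show ?thesis using one_finite by (rule le_less_trans)
qed

lemma fund_fun_pos:
  assumes "0 < t" shows "fund_fun X t > 0"
proof (rule ccontr)
  assume "\<not> fund_fun X t > 0"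
  then have "X (indicator {0<..<t}) = 0" by (simp add: fund_fun_def)
  then have "AE s in lebesgue. s \<in> {0<..<1} \<longrightarrow> (indicator {0<..<t} s :: ennreal) = 0"
    by (subst (asm) eq_0_iff) auto
  then have "AE s in lebesgue. s \<notin> {0<..<min t 1}"
    by eventually_elim (auto simp: indicator_def split: if_splits)
  then have "emeasure lebesgue {0<..<min t 1} = 0"
    by (subst (asm) AE_iff_measurable[of "{0<..<min t 1}"]) auto
  with assms show False by simp
qed

text \<open>Within \<open>(0, 1)\<close>, every superlevel set of the indicator is \<open>A\<close>
  or empty, so rearrangement invariance sees only the measure of \<open>A\<close>.\<close>

lemma X_indicator:
  assumes A: "A \<in> sets lebesgue" "A \<subseteq> {0<..<1}"
  shows "X (indicator A) = fund_fun X (measure lebesgue A)"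
proof -
  have le1: "emeasure lebesgue A \<le> 1"
    using emeasure_mono[OF A(2), of lebesgue] by simp
  then have fin: "emeasure lebesgue A = ennreal (measure lebesgue A)"
    by (intro emeasure_eq_ennreal_measure) (auto simp: top_unique)
  have le1': "measure lebesgue A \<le> 1"
    using le1 unfolding fin by simp
  show ?thesis
    unfolding fund_fun_def
  proof (rule equimeasurable)
    fix c :: ennreal
    show "emeasure lebesgue {t \<in> {0<..<1}. c < indicator A t} =
         emeasure lebesgue {t \<in> {0<..<1}. c < indicator {0<..<measure lebesgue A} t}"
    proof (cases "c < 1")
      case True
      then have "{t \<in> {0<..<1}. c < indicator A t} = A"
        "{t \<in> {0<..<1}. c < indicator {0<..<measure lebesgue A} t} = {0<..<measure lebesgue A}"
        using A le1' by (auto simp: indicator_def split: if_splits)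
      then show ?thesis using fin by simp
    next
      case False
      then have "{t \<in> {0<..<1}. c < indicator A t} = {}"
        "{t \<in> {0<..<1}. c < indicator {0<..<measure lebesgue A} t} = {}"
        by (auto simp: indicator_def split: if_splits)
      then show ?thesis by (simp only:)
    qed
  qed (use A in auto)
qed

text \<open>Up to its midpoint, \<open>(0, a)\<close> consists of two intervals of length
  \<open>a / 2\<close>, whose indicators have equal norm.\<close>

lemma fund_fun_half:
  assumes "0 < a" "a \<le> 1"
  shows "fund_fun X a \<le> 2 * fund_fun X (a / 2)"
proof -
  have "fund_fun X a \<le> X (\<lambda>t. indicator {0<..<a/2} t + indicator {a/2<..<a} t)"
    unfolding fund_fun_def
    by (rule mono_AE; measurable?) (use AE_lebesgue_neq[of "a/2"] in \<open>auto split: split_indicator\<close>)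
  also have "\<dots> \<le> X (indicator {0<..<a/2}) + X (indicator {a/2<..<a})"
    by (rule add_le) auto
  also have "\<dots> = 2 * fund_fun X (a / 2)"
    by (subst (1 2) X_indicator) (use assms in \<open>auto simp: mult_2\<close>)
  finally show ?thesis .
qed

lemma sublevel_measurable: "{t \<in> {0<..<a}. fund_fun X t \<le> l} \<in> sets lebesgue"
proof (rule sets_lebesgue_interval, unfold is_interval_1, intro allI ballI impI)
  fix x y z assume H: "x \<in> {t \<in> {0<..<a}. fund_fun X t \<le> l}" "y \<in> {t \<in> {0<..<a}. fund_fun X t \<le> l}"
    "x \<le> z \<and> z \<le> y"
  then have "fund_fun X z \<le> l" using fund_fun_mono[of z y] by auto
  then show "z \<in> {t \<in> {0<..<a}. fund_fun X t \<le> l}" using H by auto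
qed

text \<open>A nonempty sublevel set is an interval starting at \<open>0\<close>, with right endpoint
  \<open>u\<close>. The bound is clear for every shorter interval \<open>(0, v)\<close>, and the
  Fatou property, here in the form of left continuity of the fundamental function, carries it over
  to \<open>u\<close>, whether or not \<open>u\<close> itself satisfies the inequality.\<close>

lemma X_sublevel_le:
  assumes "a \<le> 1"
  shows "X (indicator {t \<in> {0<..<a}. fund_fun X t \<le> l}) \<le> l"
proof (cases "{t \<in> {0<..<a}. fund_fun X t \<le> l} = {}")
  case True
  then show ?thesis unfolding True using X_zero by (simp add: indicator_def[abs_def])
next
  case False
  define J where "J = {t \<in> {0<..<a}. fund_fun X t \<le> l}"
  define u where "u = Sup J"
  have bdd: "bdd_above J" by (auto simp: J_def intro!: bdd_aboveI[of _ a])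
  have ne: "J \<noteq> {}" using False by (simp add: J_def)
  have Ju: "t \<le> u" if "t \<in> J" for t unfolding u_def by (rule cSup_upper[OF that bdd])
  have u0: "u > 0" using ne Ju by (fastforce simp: J_def)
  have uJ: "t \<in> J" if "0 < t" "t < u" for t
  proof -
    obtain s where "s \<in> J" "t < s"
      using \<open>t < u\<close> unfolding u_def less_cSup_iff[OF ne bdd] by blast
    then show ?thesis using that fund_fun_mono[of t s] by (auto simp: J_def)
  qed
  \<comment> \<open>These points increase to \<open>u\<close> and stay strictly below it; the shift
    \<open>n + 2\<close> keeps the first one, \<open>u / 2\<close>, positive.\<close>
  define v where "v n = u * (1 - 1 / real (n + 2))" for n :: nat
  have v: "0 < v n" "v n < u" for n using u0 by (auto simp: v_def field_simps intro: add_pos_nonneg)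
  have vlim: "v \<longlonglongrightarrow> u"
  proof -
    have "(\<lambda>n. 1 / real (n + 2)) \<longlonglongrightarrow> 0"
      using LIMSEQ_ignore_initial_segment[OF lim_1_over_n, of 2] by simp
    then have "(\<lambda>n. u * (1 - 1 / real (n + 2))) \<longlonglongrightarrow> u * (1 - 0)"
      by (intro tendsto_intros)
    then show ?thesis by (simp add: v_def[abs_def])
  qed
  have vmono: "incseq v"
    unfolding v_def incseq_def using u0 by (auto intro!: mult_left_mono divide_left_mono)
  have "X (indicator J) \<le> X (indicator {0<..<u})"
  proof (rule mono_AE)
    show "indicator J \<in> borel_measurable lebesgue"
      unfolding J_def by (intro borel_measurable_indicator sublevel_measurable)
    show "AE t in lebesgue. t \<in> {0<..<1} \<longrightarrow> (indicator J t :: ennreal) \<le> indicator {0<..<u} t"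
      using AE_lebesgue_neq[of u]
      by eventually_elim (use Ju in \<open>force simp: indicator_def J_def\<close>)
  qed auto
  also have "\<dots> \<le> l"
  proof (rule LIMSEQ_le_const2)
    show "(\<lambda>n. X (indicator {0<..<v n})) \<longlonglongrightarrow> X (indicator {0<..<u})"
    proof (rule Fatou)
      show "AE t in lebesgue. t \<in> {0<..<1} \<longrightarrow> incseq (\<lambda>k. indicator {0<..<v k} t :: ennreal) \<and>
        (\<lambda>k. indicator {0<..<v k} t :: ennreal) \<longlonglongrightarrow> indicator {0<..<u} t"
      proof (intro AE_I2 impI conjI)
        fix t :: real assume t: "t \<in> {0<..<1}"
        show "incseq (\<lambda>k. indicator {0<..<v k} t :: ennreal)"
          using vmono by (force simp: incseq_def indicator_def)
        show "(\<lambda>k. indicator {0<..<v k} t :: ennreal) \<longlonglongrightarrow> indicator {0<..<u} t"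
        proof (cases "t < u")
          case True
          have "eventually (\<lambda>k. v k > t) sequentially"
            using order_tendstoD(1)[OF vlim True] .
          then have "eventually (\<lambda>k. (indicator {0<..<v k} t :: ennreal) = indicator {0<..<u} t) sequentially"
            by eventually_elim (use True t in \<open>auto simp: indicator_def\<close>)
          then show ?thesis by (rule tendsto_eventually)
        next
          case False
          then have "(indicator {0<..<v k} t :: ennreal) = 0" for k
            using v(2)[of k] by (auto simp: indicator_def)
          then show ?thesis using False by simp
        qed
      qed
    qed auto
    show "\<exists>N. \<forall>n\<ge>N. X (indicator {0<..<v n}) \<le> l"
      using uJ[OF v] by (auto simp: J_def fund_fun_def)
  qed
  finally show ?thesis by (simp add: J_def)
qed


text \<open>Dyadic decomposition along the levels of \<open>psi\<close>. On the shell where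
  \<open>psi\<close> lies between \<open>l (Suc k)\<close> and \<open>l k\<close>, the right-hand
  side of the hypothesis is at most a constant \<open>c k\<close>, because the integral only runs
  over points with larger or equal \<open>psi\<close>. Hence \<open>G\<close> is dominated by the
  sum of \<open>c k\<close> times the indicators of the sublevel sets \<open>J k\<close>, whose
  norms are at most \<open>l k ^ m\<close>. Interchanging sum and integral leaves a geometric series
  in \<open>l k\<close>, cut off at \<open>2 * psi s\<close>.\<close>

lemma level_bound:
  assumes m: "m \<ge> 1" and a: "0 < a" "a < 1"
    and psi: "\<And>t. 0 < t \<Longrightarrow> t < 1 \<Longrightarrow> 0 < psi t"
    and phi: "\<And>t. 0 < t \<Longrightarrow> t < 1 \<Longrightarrow> fund_fun X t = ennreal (psi t ^ m)"
    and h[measurable]: "h \<in> borel_measurable lebesgue"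
    and G[measurable]: "G \<in> borel_measurable lebesgue"
    and le: "\<And>t. 0 < t \<Longrightarrow> t < 1 \<Longrightarrow>
      G t \<le> ennreal (1 / psi t ^ (m - 1)) * (\<integral>\<^sup>+ s. h s * ennreal (1 / psi s) * indicator {t<..<a} s \<partial>lebesgue)"
  shows "X G \<le> ennreal (2 ^ (m + 1)) * (\<integral>\<^sup>+ s. h s * indicator {0<..<a} s \<partial>lebesgue)"
\<comment> \<open>An infinite right-hand side is trivial. Otherwise all coefficients
  \<open>c k\<close> are finite, as homogeneity in the form \<open>cmult\<close> requires.\<close>
proof (cases "(\<integral>\<^sup>+ s. h s * indicator {0<..<a} s \<partial>lebesgue) = \<infinity>")
  case True
  then show ?thesis by (simp add: ennreal_mult_top)
next
  case False
  define l where "l k = psi a / 2 ^ k" for k :: nat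
  have l0: "l k > 0" for k using psi[of a] a by (simp add: l_def)
  define J where "J k = {t \<in> {0<..<a}. fund_fun X t \<le> ennreal (l k ^ m)}" for k
  have psi_le_iff: "fund_fun X t \<le> ennreal (z ^ m) \<longleftrightarrow> psi t \<le> z" if "0 < t" "t < 1" "0 \<le> z" for t z
    using m that psi[of t] by (simp add: phi power_mono_iff)
  have psi_mono: "psi s \<le> psi t" if "0 < s" "s \<le> t" "t < 1" for s t
  proof -
    have "psi t \<ge> 0" using psi[of t] that by auto
    then show ?thesis
      using psi_le_iff[of s "psi t"] fund_fun_mono[of s t] phi[of t] that by simp
  qed
  have J_iff: "t \<in> J k \<longleftrightarrow> 0 < t \<and> t < a \<and> psi t \<le> l k" for t k
    using psi_le_iff[of t "l k"] a l0[of k] by (auto simp: J_def)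
  have J_meas[measurable]: "J k \<in> sets lebesgue" for k
    unfolding J_def by (rule sublevel_measurable)
  \<comment> \<open>Not the shell itself but everything above its lower level, so that
    \<open>B k\<close> contains the whole interval from \<open>t\<close> to \<open>a\<close> for
    each \<open>t\<close> in the shell.\<close>
  define B where "B k = {0<..<a} - J (Suc k)" for k
  have B_meas[measurable]: "B k \<in> sets lebesgue" for k by (auto simp: B_def)
  have B_iff: "t \<in> B k \<longleftrightarrow> 0 < t \<and> t < a \<and> l (Suc k) < psi t" for t k
    by (auto simp: B_def J_iff)
  \<comment> \<open>\<open>psi\<close> is unconstrained outside \<open>(0, 1)\<close>; setting its
    reciprocal to zero there makes the superlevel sets intervals, hence measurable.\<close>
  define p where "p s = (if s \<in> {0<..<1} then ennreal (1 / psi s) else 0)" for s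
  have p_meas[measurable]: "p \<in> borel_measurable lebesgue"
  proof (rule borel_measurableI_greater)
    fix c
    have "is_interval {x. c < p x}"
      unfolding is_interval_1
    proof (intro allI ballI impI)
      fix x y z assume H: "x \<in> {x. c < p x}" "y \<in> {x. c < p x}" "x \<le> z \<and> z \<le> y"
      then have xyz: "0 < x" "y < 1" "0 < z" "z < 1" "0 < y" by (auto simp: p_def split: if_splits)
      then have "p y \<le> p z" using H psi_mono[of z y] psi[of z]
        by (auto simp: p_def intro!: ennreal_leI divide_left_mono mult_pos_pos psi)
      then show "z \<in> {x. c < p x}" using H by auto
    qed
    then show "{x \<in> space lebesgue. c < p x} \<in> sets lebesgue"
      using sets_lebesgue_interval by simp
  qed
  define w where "w s = h s * p s * indicator {0<..<a} s" for s
  have w_meas[measurable]: "w \<in> borel_measurable lebesgue" unfolding w_def by measurable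
  define d where "d k = (\<integral>\<^sup>+ s. w s * indicator (B k) s \<partial>lebesgue)" for k
  define c where "c k = ennreal (1 / l (Suc k) ^ (m - 1)) * d k" for k
  have d_fin: "d k < \<infinity>" for k
  proof -
    have "d k \<le> (\<integral>\<^sup>+ s. ennreal (1 / l (Suc k)) * (h s * indicator {0<..<a} s) \<partial>lebesgue)"
      unfolding d_def
    proof (rule nn_integral_mono)
      fix s
      show "w s * indicator (B k) s \<le> ennreal (1 / l (Suc k)) * (h s * indicator {0<..<a} s)"
      proof (cases "s \<in> B k")
        case True
        then have "p s \<le> ennreal (1 / l (Suc k))"
          using a l0[of "Suc k"] by (auto simp: p_def B_iff intro!: ennreal_leI divide_left_mono mult_pos_pos psi)
        then have "h s * p s \<le> h s * ennreal (1 / l (Suc k))" by (rule mult_left_mono) simp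
        then show ?thesis using True by (auto simp: w_def B_iff mult.commute)
      qed simp
    qed
    also have "\<dots> < \<infinity>"
      using False by (subst nn_integral_cmult) (auto simp: ennreal_mult_less_top less_top)
    finally show ?thesis .
  qed
  have c_fin: "c k < \<infinity>" for k using d_fin[of k] by (simp add: c_def ennreal_mult_less_top)
  have "X G \<le> X (\<lambda>t. \<Sum>k. c k * indicator (J k) t)"
  proof (rule mono)
    fix t :: real assume t: "0 < t" "t < 1"
    show "G t \<le> (\<Sum>k. c k * indicator (J k) t)"
    proof (cases "t < a")
      case False
      then have "{t<..<a} = {}" by auto
      then show ?thesis using le[OF t] by simp
    next
      case ta: True
      \<comment> \<open>The levels tend to zero while \<open>psi t\<close> is positive. The least
        such index identifies the shell of \<open>t\<close>, since minimality gives
        \<open>psi t <= l k\<close>.\<close>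
      have "\<exists>k. l (Suc k) < psi t"
      proof -
        obtain k where "psi a / psi t < 2 ^ k" using real_arch_pow[of 2 "psi a / psi t"] by auto
        then have "l k < psi t" using psi[OF t] by (simp add: l_def field_simps)
        moreover have "l (Suc k) < l k" using psi[of a] a by (simp add: l_def field_simps)
        ultimately show ?thesis by (meson less_trans)
      qed
      then obtain k where k: "l (Suc k) < psi t" "\<And>j. j < k \<Longrightarrow> \<not> l (Suc j) < psi t"
        unfolding exists_least_iff[of "\<lambda>k. l (Suc k) < psi t"] by blast
      have "psi t \<le> l k"
      proof (cases k)
        case 0 then show ?thesis using psi_mono[of t a] ta t a by (simp add: l_def)
      next
        case (Suc j) then show ?thesis using k(2)[of j] by simp
      qed
      then have tJ: "t \<in> J k" using t ta by (simp add: J_iff)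
      have "G t \<le> ennreal (1 / psi t ^ (m - 1)) * (\<integral>\<^sup>+ s. h s * ennreal (1 / psi s) * indicator {t<..<a} s \<partial>lebesgue)"
        by (rule le[OF t])
      also have "\<dots> \<le> c k"
        unfolding c_def d_def
      proof (rule mult_mono)
        show "ennreal (1 / psi t ^ (m - 1)) \<le> ennreal (1 / l (Suc k) ^ (m - 1))"
          using k(1) l0[of "Suc k"] psi[OF t]
          by (intro ennreal_leI divide_left_mono power_mono mult_pos_pos zero_less_power) auto
        show "(\<integral>\<^sup>+ s. h s * ennreal (1 / psi s) * indicator {t<..<a} s \<partial>lebesgue)
            \<le> (\<integral>\<^sup>+ s. w s * indicator (B k) s \<partial>lebesgue)"
        proof (rule nn_integral_mono)
          fix s
          show "h s * ennreal (1 / psi s) * indicator {t<..<a} s \<le> w s * indicator (B k) s"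
          proof (cases "s \<in> {t<..<a}")
            case True
            then have "s \<in> B k" using psi_mono[of t s] k(1) t a by (auto simp: B_iff)
            then show ?thesis using True a t by (auto simp: w_def p_def)
          qed simp
        qed
      qed auto
      also have "c k = (\<Sum>j\<in>{k}. c j * indicator (J j) t)" using tJ by simp
      also have "\<dots> \<le> (\<Sum>k. c k * indicator (J k) t)"
        by (rule sum_le_suminf) auto
      finally show ?thesis .
    qed
  qed measurable
  also have "\<dots> \<le> (\<Sum>k. X (\<lambda>t. c k * indicator (J k) t))"
    by (rule suminf_le) measurable
  also have "\<dots> \<le> (\<Sum>k. \<integral>\<^sup>+ s. ennreal (2 ^ (m - 1) * l k) * (w s * indicator (B k) s) \<partial>lebesgue)"
  proof (intro Series.suminf_le summableI)
    fix k
    have "X (\<lambda>t. c k * indicator (J k) t) = c k * X (indicator (J k))"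
      using c_fin by (intro cmult) measurable
    also have "\<dots> \<le> c k * ennreal (l k ^ m)"
      unfolding J_def using a by (intro mult_left_mono X_sublevel_le) auto
    also have "\<dots> = ennreal (1 / l (Suc k) ^ (m - 1) * l k ^ m) * d k"
      using l0[of k] l0[of "Suc k"]
      by (subst ennreal_mult) (auto simp: c_def mult_ac intro: less_imp_le)
    also have "1 / l (Suc k) ^ (m - 1) * l k ^ m = 2 ^ (m - 1) * l k"
    proof -
      have "l k = 2 * l (Suc k)" by (simp add: l_def)
      moreover have "m = Suc (m - 1)" using m by simp
      ultimately have "l k ^ m = 2 ^ (m - 1) * l (Suc k) ^ (m - 1) * l k"
        by (metis power_Suc2 power_mult_distrib)
      then show ?thesis using l0[of "Suc k"] by simp
    qed
    also have "ennreal (2 ^ (m - 1) * l k) * d k = (\<integral>\<^sup>+ s. ennreal (2 ^ (m - 1) * l k) * (w s * indicator (B k) s) \<partial>lebesgue)"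
      unfolding d_def by (subst nn_integral_cmult) auto
    finally show "X (\<lambda>t. c k * indicator (J k) t) \<le> \<dots>" .
  qed
  also have "\<dots> = (\<integral>\<^sup>+ s. (\<Sum>k. ennreal (2 ^ (m - 1) * l k) * (w s * indicator (B k) s)) \<partial>lebesgue)"
    by (rule nn_integral_suminf[symmetric]) measurable
  also have "\<dots> \<le> (\<integral>\<^sup>+ s. ennreal (2 ^ (m + 1)) * (h s * indicator {0<..<a} s) \<partial>lebesgue)"
  proof (rule nn_integral_mono)
    fix s
    show "(\<Sum>k. ennreal (2 ^ (m - 1) * l k) * (w s * indicator (B k) s))
        \<le> ennreal (2 ^ (m + 1)) * (h s * indicator {0<..<a} s)"
    proof (cases "s \<in> {0<..<a}")
      case False
      then show ?thesis by (simp add: w_def)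
    next
      case True
      have ws: "w s = h s * ennreal (1 / psi s)" using True a by (simp add: w_def p_def)
      have ps: "psi s > 0" using True a psi[of s] by auto
      \<comment> \<open>\<open>s\<close> lies in \<open>B k\<close> exactly when
        \<open>l (Suc k) < psi s\<close>, that is \<open>l k < 2 * psi s\<close>. The dyadic sum is
        therefore used with threshold \<open>2 * psi s\<close> and gives at most
        \<open>4 * psi s\<close>, which cancels the \<open>1 / psi s\<close> in
        \<open>w\<close>.\<close>
      have "(\<Sum>k. ennreal (2 ^ (m - 1) * l k) * (w s * indicator (B k) s))
          = (\<Sum>k. ennreal (2 ^ (m - 1)) * w s * ennreal (psi a / 2 ^ k * of_bool (psi a / 2 ^ k < 2 * psi s)))"
      proof (rule suminf_cong)
        fix k
        have "ennreal (2 ^ (m - 1) * l k) = ennreal (2 ^ (m - 1)) * ennreal (l k)"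
          using l0[of k] by (intro ennreal_mult) auto
        then show "ennreal (2 ^ (m - 1) * l k) * (w s * indicator (B k) s) =
            ennreal (2 ^ (m - 1)) * w s * ennreal (psi a / 2 ^ k * of_bool (psi a / 2 ^ k < 2 * psi s))"
          using True by (auto simp: B_iff indicator_def l_def mult_ac)
      qed
      also have "\<dots> = ennreal (2 ^ (m - 1)) * w s * (\<Sum>k. ennreal (psi a / 2 ^ k * of_bool (psi a / 2 ^ k < 2 * psi s)))"
        by simp
      also have "\<dots> \<le> ennreal (2 ^ (m - 1)) * w s * ennreal (2 * (2 * psi s))"
        using psi[of a] a ps by (intro mult_left_mono suminf_dyadic_le) auto
      also have "ennreal (2 ^ (m - 1)) * w s * ennreal (2 * (2 * psi s))
          = ennreal (2 ^ (m - 1) * (1 / psi s) * (2 * (2 * psi s))) * h s"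
        unfolding ws using ps by (simp add: ennreal_mult'[symmetric] mult_ac)
      also have "2 ^ (m - 1) * (1 / psi s) * (2 * (2 * psi s)) = 2 ^ (m - 1) * 4" using ps by simp
      also have "2 ^ (m - 1) * 4 = (2::real) ^ (m + 1)"
        using m by (cases m) auto
      finally show ?thesis using True by simp
    qed
  qed
  also have "\<dots> = ennreal (2 ^ (m + 1)) * (\<integral>\<^sup>+ s. h s * indicator {0<..<a} s \<partial>lebesgue)"
    by (rule nn_integral_cmult) measurable
  finally show ?thesis .
qed

end

section \<open>Decreasing rearrangement and averaging\<close>

lemma sigma_finite_measure_lebesgue: "sigma_finite_measure (lebesgue :: real measure)"
proof
  obtain \<A> :: "real set set" where "countable \<A>" "\<A> \<subseteq> sets lborel" "\<Union>\<A> = space lborel"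
    "\<forall>a\<in>\<A>. emeasure lborel a \<noteq> \<infinity>"
    using lborel.sigma_finite_countable by blast
  then show "\<exists>\<A>. countable \<A> \<and> \<A> \<subseteq> sets lebesgue \<and> \<Union>\<A> = space lebesgue \<and>
      (\<forall>a\<in>\<A>. emeasure (lebesgue :: real measure) a \<noteq> \<infinity>)"
    by (intro exI[of _ \<A>]) auto
qed

text \<open>The layer-cake identity for a single value; for the value infinity the set is a
  half-line.\<close>

lemma emeasure_lborel_less_ennreal:
  "emeasure lborel {c. 0 < c \<and> ennreal c < x} = x"
proof (cases x)
  case (real r)
  then have "{c. 0 < c \<and> ennreal c < x} = {0<..<r}"
    by (auto simp: ennreal_less_iff)
  with real show ?thesis by simp
next
  case top
  have n: "ennreal (real n) \<le> emeasure lborel {c. 0 < c \<and> ennreal c < x}" for n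
  proof -
    have "emeasure lborel {0<..<real n} \<le> emeasure lborel {c. 0 < c \<and> ennreal c < x}"
      using top by (intro emeasure_mono) auto
    then show ?thesis by simp
  qed
  have "emeasure lborel {c. 0 < c \<and> ennreal c < x} = top"
  proof (cases "emeasure lborel {c. 0 < c \<and> ennreal c < x}")
    case (real r)
    obtain n where "r < real n" using reals_Archimedean2 by blast
    with n[of n] real show ?thesis by simp
  qed simp
  then show ?thesis using top by simp
qed

text \<open>Each value of \<open>f\<close> is the length of the set of levels below it, and Fubini
  exchanges levels and points. The formula shows that an integral depends only on the distribution
  of the integrand.\<close>

lemma layer_cake:
  fixes f :: "real \<Rightarrow> ennreal"
  assumes [measurable]: "f \<in> borel_measurable lebesgue" "A \<in> sets lebesgue"
  shows "(\<integral>\<^sup>+ t. f t * indicator A t \<partial>lebesgue)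
    = (\<integral>\<^sup>+ c. emeasure lebesgue {t \<in> A. f t > ennreal c} * indicator {0<..} c \<partial>lborel)"
proof -
  interpret pair_sigma_finite "lebesgue :: real measure" "lborel :: real measure"
    by (simp add: pair_sigma_finite_def sigma_finite_measure_lebesgue lborel.sigma_finite_measure_axioms)
  have "(\<integral>\<^sup>+ t. f t * indicator A t \<partial>lebesgue)
      = (\<integral>\<^sup>+ t. \<integral>\<^sup>+ c. (if 0 < c \<and> ennreal c < f t then indicator A t else 0) \<partial>lborel \<partial>lebesgue)"
  proof (rule nn_integral_cong)
    fix t
    have "(\<integral>\<^sup>+ c. (if 0 < c \<and> ennreal c < f t then indicator A t else 0) \<partial>lborel)
        = (\<integral>\<^sup>+ c. indicator A t * indicator {c. 0 < c \<and> ennreal c < f t} c \<partial>lborel)"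
      by (intro nn_integral_cong) auto
    also have "\<dots> = indicator A t * f t"
      by (subst nn_integral_cmult_indicator) (auto simp: emeasure_lborel_less_ennreal)
    finally show "f t * indicator A t = (\<integral>\<^sup>+ c. (if 0 < c \<and> ennreal c < f t then indicator A t else 0) \<partial>lborel)"
      by (simp add: mult.commute)
  qed
  also have "\<dots> = (\<integral>\<^sup>+ c. \<integral>\<^sup>+ t. (if 0 < c \<and> ennreal c < f t then indicator A t else 0) \<partial>lebesgue \<partial>lborel)"
    by (rule Fubini'[of "\<lambda>t c. if 0 < c \<and> ennreal c < f t then indicator A t else 0", symmetric])
      measurable
  also have "\<dots> = (\<integral>\<^sup>+ c. emeasure lebesgue {t \<in> A. f t > ennreal c} * indicator {0<..} c \<partial>lborel)"
  proof (rule nn_integral_cong)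
    fix c :: real
    have m: "{t \<in> A. f t > ennreal c} \<in> sets lebesgue"
    proof -
      have "{t \<in> A. f t > ennreal c} = A \<inter> {t \<in> space lebesgue. f t > ennreal c}" by auto
      also have "\<dots> \<in> sets lebesgue" using assms(2) by (intro sets.Int) (simp, measurable)
      finally show ?thesis .
    qed
    have "(\<integral>\<^sup>+ t. (if 0 < c \<and> ennreal c < f t then indicator A t else 0) \<partial>lebesgue)
        = (\<integral>\<^sup>+ t. indicator {0<..} c * indicator {t \<in> A. f t > ennreal c} t \<partial>lebesgue)"
      by (intro nn_integral_cong) (auto simp: indicator_def)
    also have "\<dots> = indicator {0<..} c * emeasure lebesgue {t \<in> A. f t > ennreal c}"
      by (rule nn_integral_cmult_indicator[OF m])
    finally show "(\<integral>\<^sup>+ t. (if 0 < c \<and> ennreal c < f t then indicator A t else 0) \<partial>lebesgue)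
        = emeasure lebesgue {t \<in> A. f t > ennreal c} * indicator {0<..} c"
      by (simp add: mult.commute)
  qed
  finally show ?thesis .
qed

text \<open>With \<open>L1norm\<close> as an instance of \<open>ri\<close>,
  \<open>level_bound\<close> and the test-function estimate apply to it in part (b). Invariance is
  the layer-cake formula, and the Fatou property is monotone convergence.\<close>

lemma ri_norm_L1norm: "ri_norm L1norm"
  unfolding ri_norm_def
proof (intro conjI)
  show "\<forall>f \<in> borel_measurable lebesgue.
        L1norm f = 0 \<longleftrightarrow> (AE t in lebesgue. t \<in> {0<..<1} \<longrightarrow> f t = 0)"
  proof
    fix f :: "real \<Rightarrow> ennreal" assume [measurable]: "f \<in> borel_measurable lebesgue"
    have "L1norm f = 0 \<longleftrightarrow> (AE t in lebesgue. f t * indicator {0<..<1} t = 0)"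
      unfolding L1norm_def by (rule nn_integral_0_iff_AE) measurable
    also have "\<dots> \<longleftrightarrow> (AE t in lebesgue. t \<in> {0<..<1} \<longrightarrow> f t = 0)"
      by (intro AE_cong) (auto simp: indicator_def)
    finally show "L1norm f = 0 \<longleftrightarrow> (AE t in lebesgue. t \<in> {0<..<1} \<longrightarrow> f t = 0)" .
  qed
  show "\<forall>f \<in> borel_measurable lebesgue. \<forall>a::real. a \<ge> 0 \<longrightarrow>
        L1norm (\<lambda>t. ennreal a * f t) = ennreal a * L1norm f"
    by (auto simp: L1norm_def mult.assoc nn_integral_cmult)
  show "\<forall>f \<in> borel_measurable lebesgue. \<forall>g \<in> borel_measurable lebesgue.
        L1norm (\<lambda>t. f t + g t) \<le> L1norm f + L1norm g"
    by (auto simp: L1norm_def distrib_right nn_integral_add)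
  show "\<forall>f \<in> borel_measurable lebesgue. \<forall>g \<in> borel_measurable lebesgue.
        (AE t in lebesgue. t \<in> {0<..<1} \<longrightarrow> f t \<le> g t) \<longrightarrow> L1norm f \<le> L1norm g"
    unfolding L1norm_def by (auto intro!: nn_integral_mono_AE simp: indicator_def)
  show "\<forall>F f. (\<forall>k. F k \<in> borel_measurable lebesgue) \<longrightarrow> f \<in> borel_measurable lebesgue \<longrightarrow>
        (AE t in lebesgue. t \<in> {0<..<1} \<longrightarrow>
            incseq (\<lambda>k. F k t) \<and> (\<lambda>k. F k t) \<longlonglongrightarrow> f t) \<longrightarrow>
        incseq (\<lambda>k. L1norm (F k)) \<and> (\<lambda>k. L1norm (F k)) \<longlonglongrightarrow> L1norm f"
  proof (intro allI impI)
    fix F :: "nat \<Rightarrow> real \<Rightarrow> ennreal" and f :: "real \<Rightarrow> ennreal"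
    assume Fm: "\<forall>k. F k \<in> borel_measurable lebesgue" and fm: "f \<in> borel_measurable lebesgue"
      and ae: "AE t in lebesgue. t \<in> {0<..<1} \<longrightarrow> incseq (\<lambda>k. F k t) \<and> (\<lambda>k. F k t) \<longlonglongrightarrow> f t"
    note [measurable] = Fm[rule_format] fm
    have inc: "AE t in lebesgue. F k t * indicator {0<..<1} t \<le> F (Suc k) t * indicator {0<..<1} t" for k
      using ae by eventually_elim (auto simp: incseq_Suc_iff indicator_def)
    have "L1norm f = (\<integral>\<^sup>+ t. (SUP k. F k t * indicator {0<..<1} t) \<partial>lebesgue)"
      unfolding L1norm_def
    proof (rule nn_integral_cong_AE)
      show "AE t in lebesgue. f t * indicator {0<..<1} t = (SUP k. F k t * indicator {0<..<1} t)"
        using ae by eventually_elim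
          (auto simp: indicator_def bot_ennreal intro: LIMSEQ_unique LIMSEQ_SUP)
    qed
    also have "\<dots> = (SUP k. L1norm (F k))"
      unfolding L1norm_def using inc
      by (intro nn_integral_monotone_convergence_SUP_AE[where f = "\<lambda>k t. F k t * indicator {0<..<1} t"]) measurable
    finally have eq: "L1norm f = (SUP k. L1norm (F k))" .
    have i: "incseq (\<lambda>k. L1norm (F k))"
      unfolding L1norm_def by (intro incseq_SucI nn_integral_mono_AE inc)
    show "incseq (\<lambda>k. L1norm (F k)) \<and> (\<lambda>k. L1norm (F k)) \<longlonglongrightarrow> L1norm f"
      using i LIMSEQ_SUP[OF i] by (simp add: eq)
  qed
  show "L1norm (\<lambda>_. 1) < \<infinity>" by (simp add: L1norm_def)
  show "\<exists>C::real. \<forall>f \<in> borel_measurable lebesgue.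
        (\<integral>\<^sup>+ t. f t * indicator {0<..<1} t \<partial>lebesgue) \<le> ennreal C * L1norm f"
    by (intro exI[of _ 1]) (simp add: L1norm_def)
  show "\<forall>f \<in> borel_measurable lebesgue. \<forall>g \<in> borel_measurable lebesgue.
        (\<forall>c::ennreal. emeasure lebesgue {t \<in> {0<..<1}. f t > c}
                      = emeasure lebesgue {t \<in> {0<..<1}. g t > c}) \<longrightarrow> L1norm f = L1norm g"
    unfolding L1norm_def by (auto simp: layer_cake)
qed

interpretation L1: ri L1norm by (rule ri.intro[OF ri_norm_L1norm])

lemma fund_fun_L1norm: "0 \<le> t \<Longrightarrow> t \<le> 1 \<Longrightarrow> fund_fun L1norm t = ennreal t"
proof -
  assume t: "0 \<le> t" "t \<le> 1"
  have "fund_fun L1norm t = (\<integral>\<^sup>+ s. indicator {0<..<t} s \<partial>lebesgue)"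
    unfolding fund_fun_def L1norm_def
    by (intro nn_integral_cong) (use t in \<open>auto simp: indicator_def\<close>)
  then show ?thesis using t by simp
qed

text \<open>The decreasing rearrangement, usually the infimum of the levels at which the
  distribution function is at most \<open>t\<close>. The supremum of the complementary levels makes
  \<open>c < rearr f t\<close> unfold directly. Since \<open>ennreal\<close> truncates, negative
  \<open>t\<close> give the value at \<open>0\<close>, which keeps the function decreasing on the
  whole line.\<close>

definition rearr :: "(real \<Rightarrow> ennreal) \<Rightarrow> real \<Rightarrow> ennreal" where
  "rearr f t = (SUP c \<in> {c. ennreal t < emeasure lebesgue {s \<in> {0<..<1}. f s > c}}. c)"

lemma antimono_rearr: "antimono (rearr f)"
  unfolding rearr_def
  by (intro antimonoI SUP_subset_mono) (auto intro: le_less_trans ennreal_leI)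

lemma superlevel_measurable:
  assumes [measurable]: "f \<in> borel_measurable lebesgue"
  shows "{s \<in> {0<..<1::real}. f s > (c::ennreal)} \<in> sets lebesgue"
proof -
  have "{s \<in> {0<..<1}. f s > c} = {0<..<1} \<inter> {s \<in> space lebesgue. f s > c}" by auto
  also have "\<dots> \<in> sets lebesgue" by (intro sets.Int) (simp, measurable)
  finally show ?thesis .
qed

text \<open>Right continuity of the distribution function: the set where \<open>f > c\<close> is the
  increasing union of the sets where \<open>f > c + 1 / Suc n\<close>, so an inequality that is
  strict at \<open>c\<close> persists at some larger level.\<close>

lemma less_rearr_iff:
  assumes f: "f \<in> borel_measurable lebesgue"
  shows "c < rearr f t \<longleftrightarrow> ennreal t < emeasure lebesgue {s \<in> {0<..<1}. f s > c}"
proof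
  assume "c < rearr f t"
  then obtain c' where c': "c < c'" "ennreal t < emeasure lebesgue {s \<in> {0<..<1}. f s > c'}"
    unfolding rearr_def less_SUP_iff by blast
  have "emeasure lebesgue {s \<in> {0<..<1}. f s > c'} \<le> emeasure lebesgue {s \<in> {0<..<1}. f s > c}"
    using c' by (intro emeasure_mono superlevel_measurable[OF f]) auto
  with c' show "ennreal t < emeasure lebesgue {s \<in> {0<..<1}. f s > c}" by simp
next
  assume t: "ennreal t < emeasure lebesgue {s \<in> {0<..<1}. f s > c}"
  show "c < rearr f t"
  proof (cases c)
    case top
    with t show ?thesis by simp
  next
    case (real r)
    define d where "d n = ennreal (r + 1 / real (Suc n))" for n
    have cd: "c < d n" for n using real by (auto simp: d_def intro!: ennreal_lessI add_nonneg_pos)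
    have "{s \<in> {0<..<1}. f s > c} = (\<Union>n. {s \<in> {0<..<1}. f s > d n})"
    proof safe
      fix s assume s: "s \<in> {0<..<1}" "c < f s"
      have "\<exists>n. d n < f s"
      proof (cases "f s")
        case top then show ?thesis by (auto simp: d_def)
      next
        case (real q)
        with s \<open>c = ennreal r\<close> \<open>0 \<le> r\<close> have "r < q" by (simp add: ennreal_less_iff)
        then obtain n where "1 / real (Suc n) < q - r"
          using nat_approx_posE[of "q - r"] by auto
        then have "r + 1 / real (Suc n) < q" by simp
        moreover have "0 < q" using \<open>0 \<le> r\<close> \<open>r < q\<close> by simp
        ultimately have "d n < f s" unfolding d_def real by (intro ennreal_lessI)
        then show ?thesis ..
      qed
      then show "s \<in> (\<Union>n. {s \<in> {0<..<1}. f s > d n})" using s by auto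
    next
      fix s n assume "d n < f s"
      then show "c < f s" using cd[of n] by simp
    qed
    moreover have "(SUP n. emeasure lebesgue {s \<in> {0<..<1}. f s > d n}) = emeasure lebesgue (\<Union>n. {s \<in> {0<..<1}. f s > d n})"
    proof (rule SUP_emeasure_incseq)
      show "range (\<lambda>n. {s \<in> {0<..<1}. f s > d n}) \<subseteq> sets lebesgue"
        using superlevel_measurable[OF f] by auto
      have "d (Suc n) \<le> d n" for n
        unfolding d_def by (intro ennreal_leI add_left_mono divide_left_mono) auto
      then show "incseq (\<lambda>n. {s \<in> {0<..<1}. f s > d n})"
        by (intro incseq_SucI) (auto intro: le_less_trans)
    qed
    ultimately have "ennreal t < (SUP n. emeasure lebesgue {s \<in> {0<..<1}. f s > d n})" using t by simp
    then obtain n where "ennreal t < emeasure lebesgue {s \<in> {0<..<1}. f s > d n}"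
      unfolding less_SUP_iff by blast
    then have "d n \<le> rearr f t" unfolding rearr_def by (intro SUP_upper) auto
    with cd[of n] show ?thesis by simp
  qed
qed

lemma rearr_measurable: "rearr f \<in> borel_measurable lebesgue"
  using borel_measurable_antimono[OF antimono_rearr] by (simp add: measurable_completion)

text \<open>By \<open>less_rearr_iff\<close> the superlevel set in \<open>(0, 1)\<close> is exactly
  \<open>(0, r)\<close>, where \<open>r\<close> is the measure of the superlevel set of
  \<open>f\<close>.\<close>

lemma rearr_equimeasurable:
  assumes f: "f \<in> borel_measurable lebesgue"
  shows "emeasure lebesgue {t \<in> {0<..<1}. rearr f t > c} = emeasure lebesgue {t \<in> {0<..<1}. f t > c}"
proof -
  have le1: "emeasure lebesgue {t \<in> {0<..<1}. f t > c} \<le> 1"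
  proof -
    have "emeasure lebesgue {t \<in> {0<..<1}. f t > c} \<le> emeasure lebesgue {0<..<1::real}"
      by (rule emeasure_mono) auto
    then show ?thesis by simp
  qed
  then obtain r where r: "0 \<le> r" "emeasure lebesgue {t \<in> {0<..<1}. f t > c} = ennreal r"
    by (cases "emeasure lebesgue {t \<in> {0<..<1}. f t > c}") (auto simp: top_unique)
  with le1 have "r \<le> 1" by simp
  have "{t \<in> {0<..<1}. rearr f t > c} = {0<..<r}"
    unfolding less_rearr_iff[OF f] r(2) using \<open>r \<le> 1\<close> r(1) by (auto simp: ennreal_less_iff)
  then have "emeasure lebesgue {t \<in> {0<..<1}. rearr f t > c} = emeasure lebesgue {0<..<r}" by (simp only:)
  also have "\<dots> = ennreal r" using r by simp
  finally show ?thesis using r by simp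
qed

section \<open>Cyclic shifts of functions supported in an initial interval\<close>

lemma emeasure_lborel_translate:
  assumes "A \<in> sets borel"
  shows "emeasure lborel {t. t + d \<in> A} = emeasure lborel (A :: real set)"
proof -
  have "emeasure lborel A = emeasure (distr lborel borel ((+) d)) A"
    by (simp add: lborel_distr_plus)
  also have "\<dots> = emeasure lborel ((+) d -` A \<inter> space lborel)"
    using assms by (intro emeasure_distr) auto
  also have "(+) d -` A \<inter> space lborel = {t. t + d \<in> A}" by (auto simp: add.commute)
  finally show ?thesis by simp
qed

definition rot :: "real \<Rightarrow> real \<Rightarrow> (real \<Rightarrow> ennreal) \<Rightarrow> real \<Rightarrow> ennreal" where
  "rot b d f t = (if 0 < t \<and> t + d < b then f (t + d)
     else if b < t + d \<and> t < b then f (t + d - b) else 0)"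

text \<open>The value \<open>0\<close> at the wrap-around point \<open>t + d = b\<close> is irrelevant, being taken on a null set.\<close>

lemma rot_measurable:
  assumes [measurable]: "f \<in> borel_measurable borel"
  shows "rot b d f \<in> borel_measurable borel"
  unfolding rot_def by measurable

text \<open>The part of \<open>f\<close> on \<open>(d, b)\<close> is translated to
  \<open>(0, b - d)\<close> and the part on \<open>(0, d)\<close> to \<open>(b - d, b)\<close>. Both
  translations preserve measure, and only the cut point \<open>d\<close> is lost.\<close>

lemma rot_equimeasurable:
  assumes f[measurable]: "f \<in> borel_measurable borel" and d: "0 \<le> d" "d < b" "b \<le> 1"
    and f0: "\<And>t. b \<le> t \<Longrightarrow> f t = 0"
  shows "emeasure lebesgue {t \<in> {0<..<1}. rot b d f t > c} = emeasure lebesgue {t \<in> {0<..<1}. f t > c}"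
proof -
  define S1 where "S1 = {t. d < t \<and> t < b \<and> f t > c}"
  define S2 where "S2 = {t. 0 < t \<and> t < d \<and> f t > c}"
  have [measurable]: "S1 \<in> sets borel" "S2 \<in> sets borel" unfolding S1_def S2_def by measurable
  have m1: "{t. t + d \<in> S1} \<in> sets borel" "{t. t + (d - b) \<in> S2} \<in> sets borel" by measurable
  have "{t \<in> {0<..<1}. rot b d f t > c} = {t. t + d \<in> S1} \<union> {t. t + (d - b) \<in> S2}"
    using d by (auto simp: rot_def S1_def S2_def algebra_simps split: if_splits)
  then have "emeasure lebesgue {t \<in> {0<..<1}. rot b d f t > c}
      = emeasure lborel ({t. t + d \<in> S1} \<union> {t. t + (d - b) \<in> S2})" using m1 by simp
  also have "\<dots> = emeasure lborel {t. t + d \<in> S1} + emeasure lborel {t. t + (d - b) \<in> S2}"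
    using m1 d by (subst plus_emeasure[symmetric]) (auto simp: S1_def S2_def)
  also have "\<dots> = emeasure lborel S1 + emeasure lborel S2"
    by (subst (1 2) emeasure_lborel_translate) auto
  also have "\<dots> = emeasure lborel (S1 \<union> S2)"
    by (subst plus_emeasure) (auto simp: S1_def S2_def)
  also have "\<dots> = emeasure lborel {t \<in> {0<..<1}. f t > c}"
  proof (rule emeasure_eq_AE)
    show "AE t in lborel. t \<in> S1 \<union> S2 \<longleftrightarrow> t \<in> {t \<in> {0<..<1}. f t > c}"
      using AE_lborel_singleton[of d]
      by eventually_elim (use d f0 in \<open>auto simp: S1_def S2_def not_less[symmetric] split: if_splits\<close>,
         (metis not_less not_less_zero f0)+)
  qed measurable
  also have "\<dots> = emeasure lebesgue {t \<in> {0<..<1}. f t > c}" by simp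
  finally show ?thesis .
qed

section \<open>Averaging over shifts, and comparison of \<open>X\<close> with
  \<open>L^1\<close>\<close>

context ri
begin

text \<open>For fixed \<open>t\<close>, the shifts by multiples of \<open>h\<close> evaluate
  \<open>f\<close> on a cyclic grid of spacing \<open>h\<close> in \<open>(0, b)\<close>. Since
  \<open>f\<close> decreases, \<open>f s\<close> is at most the value at the last grid point up to
  \<open>s\<close>, so the integral over \<open>(h, b)\<close> is at most \<open>h\<close> times the
  sum of the shifts, uniformly in \<open>t\<close>. All shifts have the norm of \<open>f\<close>,
  and there are \<open>b / h\<close> of them.\<close>

lemma average_antimono_le:
  assumes f: "antimono f" and b: "0 < b" "b \<le> 1"
    and f0: "\<And>t. b \<le> t \<Longrightarrow> f t = 0"
    and fin: "(\<integral>\<^sup>+ s. f s * indicator {0<..<b} s \<partial>lebesgue) < \<infinity>"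
  shows "(\<integral>\<^sup>+ s. f s * indicator {0<..<b} s \<partial>lebesgue) * fund_fun X b \<le> ennreal b * X f"
proof -
  have fb[measurable]: "f \<in> borel_measurable borel"
    by (rule borel_measurable_antimono[OF f])
  then have fl[measurable]: "f \<in> borel_measurable lebesgue" by (simp add: measurable_completion)
  have rl[measurable]: "rot b d f \<in> borel_measurable lebesgue" for d
    using rot_measurable[OF fb, of b d] by (simp add: measurable_completion)
  have step: "(\<integral>\<^sup>+ s. f s * indicator {b / real (Suc n)<..<b} s \<partial>lebesgue) * fund_fun X b \<le> ennreal b * X f" for n
  proof -
    define M where "M = Suc n"
    define h where "h = b / real M"
    \<comment> \<open>Points closer to \<open>0\<close> than \<open>h\<close> need not have a grid
      point to their left. Letting \<open>h\<close> tend to \<open>0\<close> recovers the rest of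
      the integral.\<close>
    define c where "c = (\<integral>\<^sup>+ s. f s * indicator {h<..<b} s \<partial>lebesgue)"
    have h: "0 < h" "h * real M = b" using b by (auto simp: h_def M_def)
    have c_fin: "c < \<infinity>"
      unfolding c_def
      by (rule le_less_trans[OF nn_integral_mono fin]) (use h in \<open>auto simp: indicator_def\<close>)
    have pointwise: "c \<le> ennreal h * (\<Sum>i<M. rot b (real i * h) f t)" if t: "0 < t" "t < b" for t
    proof -
      define y where "y i = (if t + real i * h < b then t + real i * h else t + real i * h - b)" for i
      have "c \<le> (\<integral>\<^sup>+ s. (\<Sum>i<M. rot b (real i * h) f t * indicator {y i..<y i + h} s) \<partial>lebesgue)"
        unfolding c_def
      proof (rule nn_integral_mono)
        fix s
        show "f s * indicator {h<..<b} s \<le> (\<Sum>i<M. rot b (real i * h) f t * indicator {y i..<y i + h} s)"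
        proof (cases "s \<in> {h<..<b}")
          case s: True
          have "\<exists>i<M. y i \<le> s \<and> s < y i + h \<and> rot b (real i * h) f t = f (y i)"
          proof (cases "t \<le> s")
            case True
            \<comment> \<open>The last grid point \<open>t + i * h\<close> not exceeding
              \<open>s\<close>, reached without wrapping around.\<close>
            define i where "i = nat \<lfloor>(s - t) / h\<rfloor>"
            have i: "real i \<le> (s - t) / h" "(s - t) / h < real i + 1"
              using True h unfolding i_def by (auto simp: of_nat_nat)
            then have i': "real i * h \<le> s - t" "s - t < real i * h + h" using h by (auto simp: field_simps)
            have "real i * h < real M * h" using i'(1) s t h by (simp add: mult.commute)
            then have "i < M" using h by simp
            then show ?thesis using i' s t by (intro exI[of _ i]) (auto simp: y_def rot_def)
          next
            case False
            \<comment> \<open>Here \<open>t\<close> lies to the right of \<open>s\<close>, so the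
              grid point is reached after wrapping around, which adds \<open>b\<close> to the
              distance.\<close>
            define i where "i = nat \<lfloor>(s + b - t) / h\<rfloor>"
            have "0 \<le> (s + b - t) / h" using s t h by auto
            then have i: "real i \<le> (s + b - t) / h" "(s + b - t) / h < real i + 1"
              unfolding i_def by (auto simp: of_nat_nat)
            then have i': "real i * h \<le> s + b - t" "s + b - t < real i * h + h" using h by (auto simp: field_simps)
            have "real i * h < real M * h" using i'(1) False h by (simp add: mult.commute)
            then have "i < M" using h by simp
            \<comment> \<open>As \<open>s > h\<close>, the chosen shift passes strictly beyond
              \<open>b\<close> and so avoids the wrap-around point, where \<open>rot\<close> has the
              value \<open>0\<close>.\<close>
            moreover have "t + real i * h > b" using i'(2) s by auto
            ultimately show ?thesis using i' s t by (intro exI[of _ i]) (auto simp: y_def rot_def)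
          qed
          then obtain i where i: "i < M" "y i \<le> s" "s < y i + h" "rot b (real i * h) f t = f (y i)" by blast
          have "f s * indicator {h<..<b} s \<le> rot b (real i * h) f t * indicator {y i..<y i + h} s"
            using s i antimonoD[OF f i(2)] by simp
          also have "\<dots> \<le> (\<Sum>i<M. rot b (real i * h) f t * indicator {y i..<y i + h} s)"
            using i(1) by (intro member_le_sum[of i]) auto
          finally show ?thesis .
        qed simp
      qed
      also have "\<dots> = (\<Sum>i<M. rot b (real i * h) f t * ennreal h)"
      proof -
        have "(\<lambda>s. rot b (real i * h) f t * indicator {y i..<y i + h} s) \<in> borel_measurable lebesgue" for i
          by (intro borel_measurable_times_ennreal borel_measurable_const borel_measurable_indicator) simp
        then show ?thesis using h by (subst nn_integral_sum) (auto simp: nn_integral_cmult_indicator)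
      qed
      also have "\<dots> = ennreal h * (\<Sum>i<M. rot b (real i * h) f t)"
        by (simp add: sum_distrib_left mult.commute)
      finally show ?thesis .
    qed
    have "c * fund_fun X b = X (\<lambda>t. c * indicator {0<..<b} t)"
      unfolding fund_fun_def using c_fin by (subst cmult) auto
    also have "\<dots> \<le> X (\<lambda>t. ennreal h * (\<Sum>i<M. rot b (real i * h) f t))"
    proof (rule mono)
      show "c * indicator {0<..<b} t \<le> ennreal h * (\<Sum>i<M. rot b (real i * h) f t)" for t
        using pointwise[of t] by (auto simp: indicator_def)
    qed measurable
    also have "\<dots> = ennreal h * X (\<lambda>t. \<Sum>i<M. rot b (real i * h) f t)"
      by (rule cmult) measurable
    also have "\<dots> \<le> ennreal h * (\<Sum>i<M. X (rot b (real i * h) f))"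
      by (intro mult_left_mono sum_le) auto
    also have "(\<Sum>i<M. X (rot b (real i * h) f)) = (\<Sum>i<M. X f)"
    proof (intro sum.cong refl equimeasurable rot_equimeasurable)
      fix i assume "i \<in> {..<M}"
      then have "real i * h < real M * h" using h by simp
      then show "real i * h < b" using h by (simp add: mult.commute)
    qed (use h b f0 in auto)
    also have "ennreal h * (\<Sum>i<M. X f) = ennreal b * X f"
      using h by (simp add: mult.assoc[symmetric] ennreal_of_nat_eq_real_of_nat ennreal_mult[symmetric])
    finally show ?thesis by (simp add: c_def h_def M_def)
  qed
  have "(\<integral>\<^sup>+ s. f s * indicator {0<..<b} s \<partial>lebesgue)
      = (\<integral>\<^sup>+ s. (SUP n. f s * indicator {b / real (Suc n)<..<b} s) \<partial>lebesgue)"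
  proof (rule nn_integral_cong)
    fix s
    show "f s * indicator {0<..<b} s = (SUP n. f s * indicator {b / real (Suc n)<..<b} s)"
    proof (cases "s \<in> {0<..<b}")
      case True
      then obtain n where "1 / real (Suc n) < s / b"
        using nat_approx_posE[of "s / b"] b by auto
      then have n: "b / real (Suc n) < s" using b by (simp add: field_simps)
      show ?thesis
      proof (rule antisym)
        have "f s * indicator {0<..<b} s \<le> f s * indicator {b / real (Suc n)<..<b} s" using n True by simp
        also have "\<dots> \<le> (SUP n. f s * indicator {b / real (Suc n)<..<b} s)" by (rule SUP_upper) simp
        finally show "f s * indicator {0<..<b} s \<le> (SUP n. f s * indicator {b / real (Suc n)<..<b} s)" .
        show "(SUP n. f s * indicator {b / real (Suc n)<..<b} s) \<le> f s * indicator {0<..<b} s"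
          using True by (intro SUP_least) (auto simp: indicator_def)
      qed
    next
      case False
      have z: "f s * indicator {b / real (Suc n)<..<b} s = 0" for n
      proof -
        have "0 < b / real (Suc n)" using b by simp
        then have "s \<notin> {b / real (Suc n)<..<b}" using False by (smt (verit) greaterThanLessThan_iff)
        then show ?thesis by simp
      qed
      show ?thesis unfolding z using False by simp
    qed
  qed
  also have "\<dots> = (SUP n. \<integral>\<^sup>+ s. f s * indicator {b / real (Suc n)<..<b} s \<partial>lebesgue)"
  proof (rule nn_integral_monotone_convergence_SUP)
    show "incseq (\<lambda>n s. f s * indicator {b / real (Suc n)<..<b} s)"
    proof (intro incseq_SucI le_funI)
      fix n s
      have "b / real (Suc (Suc n)) \<le> b / real (Suc n)" using b by (intro divide_left_mono) auto
      then show "f s * indicator {b / real (Suc n)<..<b} s \<le> f s * indicator {b / real (Suc (Suc n))<..<b} s"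
        by (auto simp: indicator_def)
    qed
  qed measurable
  finally have eq: "(\<integral>\<^sup>+ s. f s * indicator {0<..<b} s \<partial>lebesgue)
    = (SUP n. \<integral>\<^sup>+ s. f s * indicator {b / real (Suc n)<..<b} s \<partial>lebesgue)" .
  show ?thesis
    unfolding eq SUP_mult_right_ennreal by (intro SUP_least step)
qed

text \<open>Cut \<open>f\<close> to \<open>(0, b)\<close> and pass to the decreasing rearrangement,
  which still vanishes from \<open>b\<close> on. This changes neither the \<open>L^1\<close> norm
  nor the norm \<open>X\<close> of the cut function, so \<open>average_antimono_le\<close> applies;
  the embedding into \<open>L^1\<close> supplies the finiteness it asks for.\<close>

lemma integral_initial_le:
  assumes f[measurable]: "f \<in> borel_measurable lebesgue" and b: "0 < b" "b \<le> 1" and Xf: "X f \<le> 1"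
  shows "(\<integral>\<^sup>+ s. f s * indicator {0<..<b} s \<partial>lebesgue) * fund_fun X b \<le> ennreal b"
proof -
  define g where "g s = f s * indicator {0<..<b} s" for s
  have g[measurable]: "g \<in> borel_measurable lebesgue" unfolding g_def by measurable
  have rg0: "rearr g t = 0" if "b \<le> t" for t
  proof (rule ccontr)
    assume "rearr g t \<noteq> 0"
    then have "0 < rearr g t" by (simp add: zero_less_iff_neq_zero)
    then have "ennreal t < emeasure lebesgue {s \<in> {0<..<1}. g s > 0}" by (simp add: less_rearr_iff)
    also have "\<dots> \<le> emeasure lebesgue {0<..<b}"
      by (rule emeasure_mono) (auto simp: g_def indicator_def split: if_splits)
    finally show False using that b by (simp add: ennreal_less_iff)
  qed
  have L: "L1norm (rearr g) = L1norm g"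
    by (intro L1.equimeasurable rearr_measurable rearr_equimeasurable g)
  have Lg: "L1norm g = (\<integral>\<^sup>+ s. f s * indicator {0<..<b} s \<partial>lebesgue)"
    unfolding L1norm_def g_def using b by (intro nn_integral_cong) (auto simp: indicator_def)
  have Lr: "L1norm (rearr g) = (\<integral>\<^sup>+ s. rearr g s * indicator {0<..<b} s \<partial>lebesgue)"
    unfolding L1norm_def using b rg0 by (intro nn_integral_cong) (auto simp: indicator_def)
  have Xg: "X g \<le> X f"
    by (rule mono) (auto simp: g_def indicator_def)
  obtain C where C: "\<And>f. f \<in> borel_measurable lebesgue \<Longrightarrow> L1norm f \<le> ennreal C * X f"
    using L1norm_le by blast
  have "L1norm g \<le> ennreal C * X g" by (rule C[OF g])
  also have "\<dots> < \<infinity>"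
  proof -
    have "X g < \<infinity>" using order_trans[OF Xg Xf] by (simp add: order_le_less_trans)
    then show ?thesis by (simp add: ennreal_mult_less_top)
  qed
  finally have fin: "L1norm (rearr g) < \<infinity>" using L by simp
  have "(\<integral>\<^sup>+ s. f s * indicator {0<..<b} s \<partial>lebesgue) * fund_fun X b
      = (\<integral>\<^sup>+ s. rearr g s * indicator {0<..<b} s \<partial>lebesgue) * fund_fun X b"
    using L Lg Lr by simp
  also have "\<dots> \<le> ennreal b * X (rearr g)"
    using fin b rg0 Lr by (intro average_antimono_le antimono_rearr) auto
  also have "X (rearr g) = X g"
    by (intro equimeasurable rearr_measurable rearr_equimeasurable g)
  also have "ennreal b * X g \<le> ennreal b * 1"
    using order_trans[OF Xg Xf] by (intro mult_left_mono) auto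
  finally show ?thesis by simp
qed

text \<open>Induction over measurable functions. Indicators are covered by the bound on the
  fundamental function; sums pass because \<open>X\<close> is subadditive while
  \<open>L1norm\<close> is additive, and increasing limits pass by the Fatou property.\<close>

lemma le_L1norm_if_fund_fun_le:
  assumes C: "\<And>a. 0 < a \<Longrightarrow> a < 1 \<Longrightarrow> fund_fun X a \<le> ennreal (C * a)"
    and f: "f \<in> borel_measurable lebesgue" and "0 \<le> C"
  shows "X f \<le> 2 * ennreal C * L1norm f"
  using f
proof induct
  case (cong f g)
  then have "f = g" by auto
  then show ?case using cong by simp
next
  case (set A)
  define A' where "A' = A \<inter> {0<..<1}"
  have A': "A' \<in> sets lebesgue" "A' \<subseteq> {0<..<1}" using set by (auto simp: A'_def)
  have le1: "emeasure lebesgue A' \<le> 1"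
    using emeasure_mono[OF A'(2), of lebesgue] by simp
  then have fin: "emeasure lebesgue A' = ennreal (measure lebesgue A')"
    by (intro emeasure_eq_ennreal_measure) (auto simp: top_unique)
  have le1': "measure lebesgue A' \<le> 1" using le1 unfolding fin by simp
  have "X (indicator A) \<le> X (indicator A')"
    by (rule mono) (use set A' in \<open>auto simp: A'_def indicator_def\<close>)
  also have "\<dots> = fund_fun X (measure lebesgue A')" by (rule X_indicator[OF A'])
  also have "\<dots> \<le> ennreal (2 * C * measure lebesgue A')"
  proof (cases "measure lebesgue A' = 0")
    case True
    then show ?thesis using X_zero by (simp add: fund_fun_def)
  next
    case False
    then have pos: "0 < measure lebesgue A'" by (simp add: zero_less_measure_iff)
    show ?thesis
    proof (cases "measure lebesgue A' < 1")
      case True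
      have "fund_fun X (measure lebesgue A') \<le> ennreal (C * measure lebesgue A')" by (rule C[OF pos True])
      also have "\<dots> \<le> ennreal (2 * C * measure lebesgue A')"
        using pos \<open>0 \<le> C\<close> by (intro ennreal_leI) auto
      finally show ?thesis .
    next
      case False
      then have 1: "measure lebesgue A' = 1" using le1' by simp
      \<comment> \<open>Measure one is outside the range of the hypothesis and is reached from
        \<open>1 / 2\<close> by halving the interval.\<close>
      have "fund_fun X 1 \<le> 2 * fund_fun X (1 / 2)" using fund_fun_half[of 1] by simp
      also have "\<dots> \<le> 2 * ennreal (C * (1 / 2))" using C[of "1/2"] by (intro mult_left_mono) auto
      also have "\<dots> = ennreal C"
        using \<open>0 \<le> C\<close> by (subst ennreal_numeral[symmetric], subst ennreal_mult[symmetric]) auto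
      also have "\<dots> \<le> ennreal (2 * C)" using \<open>0 \<le> C\<close> by (intro ennreal_leI) auto
      finally show ?thesis by (simp add: 1)
    qed
  qed
  also have "\<dots> = 2 * ennreal C * emeasure lebesgue A'"
    using \<open>0 \<le> C\<close> by (simp add: fin ennreal_mult)
  also have "emeasure lebesgue A' = L1norm (indicator A)"
    using nn_integral_indicator[OF A'(1)]
    by (simp add: L1norm_def A'_def indicator_inter_arith[symmetric])
  finally show ?case .
next
  case (mult u c)
  have "X (\<lambda>x. c * u x) = c * X u" using mult by (intro cmult) auto
  also have "\<dots> \<le> c * (2 * ennreal C * L1norm u)" using mult by (intro mult_left_mono) auto
  also have "\<dots> = 2 * ennreal C * L1norm (\<lambda>x. c * u x)"
    using mult by (subst L1.cmult) (auto simp: mult_ac)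
  finally show ?case .
next
  case (add u v)
  have "X (\<lambda>x. v x + u x) \<le> X v + X u" using add by (intro add_le) auto
  also have "\<dots> \<le> 2 * ennreal C * L1norm v + 2 * ennreal C * L1norm u" using add by (intro add_mono) auto
  also have "\<dots> = 2 * ennreal C * L1norm (\<lambda>x. v x + u x)"
    using add by (simp add: L1norm_def distrib_right distrib_left nn_integral_add)
  finally show ?case .
next
  case (seq U)
  have "(SUP i. U i) = (\<lambda>x. SUP i. U i x)" by (auto simp: image_comp fun_eq_iff)
  then have m: "(SUP i. U i) \<in> borel_measurable lebesgue" using seq by simp
  have conv: "AE t in lebesgue. t \<in> {0<..<1} \<longrightarrow> incseq (\<lambda>k. U k t) \<and> (\<lambda>k. U k t) \<longlonglongrightarrow> (SUP i. U i) t"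
  proof (intro AE_I2 impI)
    fix t
    have i: "incseq (\<lambda>k. U k t)" using \<open>incseq U\<close> by (auto simp: incseq_def le_fun_def)
    then show "incseq (\<lambda>k. U k t) \<and> (\<lambda>k. U k t) \<longlonglongrightarrow> (SUP i. U i) t"
      using LIMSEQ_SUP[OF i] by (simp add: image_comp)
  qed
  have "(\<lambda>k. X (U k)) \<longlonglongrightarrow> X (SUP i. U i)" using seq m conv by (intro Fatou) auto
  then show ?case
  proof (rule LIMSEQ_le_const2)
    have "X (U k) \<le> 2 * ennreal C * L1norm (SUP i. U i)" for k
    proof -
      have "L1norm (U k) \<le> L1norm (SUP i. U i)"
        using seq m by (intro L1.mono) (auto simp: image_comp intro: SUP_upper)
      then show ?thesis using seq(3)[of k] by (meson mult_left_mono order_trans zero_le)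
    qed
    then show "\<exists>N. \<forall>n\<ge>N. X (U n) \<le> 2 * ennreal C * L1norm (SUP i. U i)" by blast
  qed
qed

lemma Xspace_eq_L1space_if_fund_fun_le:
  assumes C: "\<And>a. 0 < a \<Longrightarrow> a < 1 \<Longrightarrow> fund_fun X a \<le> ennreal (C * a)" and "0 \<le> C"
  shows "Xspace X = L1space"
proof -
  obtain D where D: "\<And>f. f \<in> borel_measurable lebesgue \<Longrightarrow> L1norm f \<le> ennreal D * X f"
    using L1norm_le by blast
  have "rnorm X f < \<infinity> \<longleftrightarrow> L1norm (\<lambda>t. ennreal \<bar>f t\<bar>) < \<infinity>" if [measurable]: "f \<in> borel_measurable lebesgue" for f
  proof -
    have m: "(\<lambda>t. ennreal \<bar>f t\<bar>) \<in> borel_measurable lebesgue" by measurable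
    show ?thesis
    proof
      assume "rnorm X f < \<infinity>"
      then show "L1norm (\<lambda>t. ennreal \<bar>f t\<bar>) < \<infinity>"
        using D[OF m] by (auto simp: rnorm_def ennreal_mult_less_top intro: le_less_trans)
    next
      assume "L1norm (\<lambda>t. ennreal \<bar>f t\<bar>) < \<infinity>"
      then have "2 * ennreal C * L1norm (\<lambda>t. ennreal \<bar>f t\<bar>) < \<infinity>"
        by (simp add: ennreal_mult_less_top)
      then show "rnorm X f < \<infinity>"
        using le_L1norm_if_fund_fun_le[OF C m \<open>0 \<le> C\<close>] by (auto simp: rnorm_def intro: le_less_trans)
    qed
  qed
  then show ?thesis by (auto simp: Xspace_def L1space_def)
qed

text \<open>Gliding hump: if the ratio of the fundamental function to the identity were unbounded,
  a weighted sum of normalised indicators would be integrable but of infinite norm.\<close>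

lemma fund_fun_le_if_Xspace_eq_L1space:
  assumes eq: "Xspace X = L1space"
  obtains C where "0 < C" "\<And>a. 0 < a \<Longrightarrow> a < 1 \<Longrightarrow> fund_fun X a \<le> ennreal (C * a)"
proof (rule ccontr)
  assume not: "\<not> thesis"
  have "\<exists>a. 0 < a \<and> a < 1 \<and> fund_fun X a > ennreal (4 ^ k * a)" for k :: nat
  proof (rule ccontr)
    assume "\<nexists>a. 0 < a \<and> a < 1 \<and> fund_fun X a > ennreal (4 ^ k * a)"
    then have "\<And>a. 0 < a \<Longrightarrow> a < 1 \<Longrightarrow> fund_fun X a \<le> ennreal (4 ^ k * a)" by (meson not_le)
    then show False using that[of "4 ^ k"] not by simp
  qed
  then obtain a where a: "\<And>k. 0 < a k" "\<And>k. a k < 1" "\<And>k. fund_fun X (a k) > ennreal (4 ^ k * a k)"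
    by metis
  \<comment> \<open>The weight splits \<open>4 ^ k\<close> evenly: \<open>g k\<close> has
    \<open>L^1\<close> norm \<open>1 / 2 ^ k\<close>, which is summable, while its norm in
    \<open>X\<close> is at least \<open>2 ^ k\<close>.\<close>
  define g where "g k t = ennreal (1 / (2 ^ k * a k)) * indicator {0<..<a k} t" for k t
  have [measurable]: "g k \<in> borel_measurable lebesgue" for k unfolding g_def by measurable
  define F where "F t = (\<Sum>k. g k t)" for t
  have F[measurable]: "F \<in> borel_measurable lebesgue" unfolding F_def by measurable
  have Lg: "L1norm (g k) = ennreal ((1 / 2) ^ k)" for k
  proof -
    have "L1norm (g k) = ennreal (1 / (2 ^ k * a k)) * fund_fun L1norm (a k)"
      unfolding g_def fund_fun_def by (rule L1.cmult) auto
    also have "\<dots> = ennreal ((1 / 2) ^ k)"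
      using a(1,2)[of k] by (simp add: fund_fun_L1norm less_imp_le ennreal_mult[symmetric] power_one_over)
    finally show ?thesis .
  qed
  have LF: "L1norm F < \<infinity>"
  proof -
    have "L1norm F \<le> (\<Sum>k. L1norm (g k))" unfolding F_def by (rule L1.suminf_le) measurable
    also have "\<dots> = ennreal (\<Sum>k. (1 / 2) ^ k)"
      unfolding Lg by (rule suminf_ennreal2) (auto simp: summable_geometric)
    also have "\<dots> < \<infinity>" by simp
    finally show ?thesis .
  qed
  \<comment> \<open>The spaces consist of real functions, so \<open>F\<close> is replaced by its
    image under \<open>enn2real\<close>. The two agree almost everywhere on \<open>(0, 1)\<close>,
    because an integrable function is almost everywhere finite.\<close>
  have "AE t in lebesgue. F t * indicator {0<..<1} t \<noteq> \<infinity>"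
    using LF unfolding L1norm_def by (intro nn_integral_PInf_AE) auto
  then have ae: "AE t in lebesgue. t \<in> {0<..<1} \<longrightarrow> F t = ennreal \<bar>enn2real (F t)\<bar>"
    by eventually_elim (auto simp: indicator_def less_top)
  have m: "(\<lambda>t. enn2real (F t)) \<in> borel_measurable lebesgue" by measurable
  have "L1norm (\<lambda>t. ennreal \<bar>enn2real (F t)\<bar>) \<le> L1norm F"
    using ae by (intro L1.mono_AE) auto
  then have "(\<lambda>t. enn2real (F t)) \<in> L1space" using LF m by (auto simp: L1space_def)
  then have "rnorm X (\<lambda>t. enn2real (F t)) < \<infinity>" using eq by (auto simp: Xspace_def)
  moreover have "X F \<le> rnorm X (\<lambda>t. enn2real (F t))"
    unfolding rnorm_def using ae by (intro mono_AE) auto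
  ultimately have XF: "X F < \<infinity>" by simp
  have ge: "ennreal (2 ^ k) \<le> X F" for k
  proof -
    have "ennreal (2 ^ k) = ennreal (1 / (2 ^ k * a k)) * ennreal (4 ^ k * a k)"
      using a(1)[of k] by (simp add: ennreal_mult[symmetric] less_imp_le power_mult_distrib[symmetric] field_simps)
    also have "\<dots> \<le> ennreal (1 / (2 ^ k * a k)) * fund_fun X (a k)"
      using a(3)[of k] by (intro mult_left_mono) auto
    also have "\<dots> = X (g k)"
      unfolding g_def fund_fun_def by (rule cmult[symmetric]) auto
    also have "\<dots> \<le> X F"
    proof (rule mono)
      fix t
      have "g k t = (\<Sum>j\<in>{k}. g j t)" by simp
      also have "\<dots> \<le> F t" unfolding F_def by (rule sum_le_suminf) auto
      finally show "g k t \<le> F t" .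
    qed measurable
    finally show ?thesis .
  qed
  from XF obtain r where r: "X F = ennreal r" "0 \<le> r" by (cases "X F") auto
  obtain k where "r < 2 ^ k" using real_arch_pow[of 2 r] by auto
  with ge[of k] r show False by simp
qed

end

section \<open>Kernel estimates\<close>

lemma ennreal_mult_power: "0 \<le> x \<Longrightarrow> 0 \<le> y \<Longrightarrow> ennreal x * ennreal y ^ n = ennreal (x * y ^ n)"
  by (simp add: ennreal_mult ennreal_power)

lemma borel_measurable_root_borel: "m \<ge> 1 \<Longrightarrow> root m \<in> borel_measurable borel"
  by (intro borel_measurable_mono monoI) auto

lemma borel_measurable_root_lebesgue:
  assumes "m \<ge> 1"
  shows "root m \<in> borel_measurable lebesgue" "(\<lambda>s. root m s / s) \<in> borel_measurable lebesgue"
    "(\<lambda>s. s / root m s) \<in> borel_measurable lebesgue"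
proof -
  note [measurable] = borel_measurable_root_borel[OF assms]
  show "root m \<in> borel_measurable lebesgue" by (intro measurable_completion) simp
  have "(\<lambda>s. root m s / s) \<in> borel_measurable lborel" "(\<lambda>s. s / root m s) \<in> borel_measurable lborel"
    by measurable
  then show "(\<lambda>s. root m s / s) \<in> borel_measurable lebesgue" "(\<lambda>s. s / root m s) \<in> borel_measurable lebesgue"
    by (auto intro: measurable_completion)
qed

text \<open>The integrand is \<open>r ^ (1 / m - 1)\<close>, with antiderivative \<open>m\<close>
  times the \<open>m\<close>-th root. Dropping the lower endpoint makes the bound independent of
  \<open>t\<close>.\<close>

lemma nn_integral_root_le:
  assumes m: "m \<ge> 1" and t: "0 < t" "t \<le> s"
  shows "(\<integral>\<^sup>+ r. ennreal (root m r / r) * indicator {t<..<s} r \<partial>lebesgue) \<le> ennreal (real m * root m s)"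
proof -
  have "(\<integral>\<^sup>+ r. ennreal (root m r / r) * indicator {t<..<s} r \<partial>lebesgue)
      = (\<integral>\<^sup>+ r. ennreal (root m r / r) * indicator {t<..<s} r \<partial>lborel)"
    by (rule nn_integral_completion)
  also have "\<dots> \<le> (\<integral>\<^sup>+ r. ennreal (root m r / r) * indicator {t..s} r \<partial>lborel)"
    by (rule nn_integral_mono) (auto simp: indicator_def)
  also have "\<dots> = ennreal (real m * root m s - real m * root m t)"
  proof (rule nn_integral_FTC_Icc)
    fix r assume "r \<in> {t..s}"
    then have r: "0 < r" using t by auto
    have "DERIV (\<lambda>x. real m * root m x) r :> real m * inverse (real m * root m r ^ (m - Suc 0))"
      using m r by (intro DERIV_cmult DERIV_real_root) auto
    also have "real m * inverse (real m * root m r ^ (m - Suc 0)) = root m r / r"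
    proof -
      have "root m r * root m r ^ (m - Suc 0) = root m r ^ m"
        using m by (simp add: power_Suc[symmetric] del: power_Suc)
      also have "\<dots> = r" using m r by simp
      finally have "root m r * root m r ^ (m - Suc 0) = r" .
      then show ?thesis using m r by (simp add: field_simps)
    qed
    finally show "DERIV (\<lambda>x. real m * root m x) r :> root m r / r" .
    show "0 \<le> root m r / r" using m r by simp
  next
    show "(\<lambda>r. root m r / r) \<in> borel_measurable borel"
      using borel_measurable_root_borel[OF m] by measurable
  qed (use t in auto)
  also have "\<dots> \<le> ennreal (real m * root m s)"
    using m t by (intro ennreal_leI) auto
  finally show ?thesis .
qed

text \<open>Both domains of integration shrink as \<open>t\<close> grows. Monotonicity in
  \<open>t\<close> is what makes the image of an arbitrary \<open>f\<close> measurable.\<close>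

lemma HI_antimono: "antimono (HI m I f)"
proof (rule antimonoI)
  fix t t' :: real assume t: "t \<le> t'"
  have i: "indicator {t'<..<b} r \<le> (indicator {t<..<b} r :: ennreal)" for b r :: real
    using t by (auto simp: indicator_def)
  show "HI m I f t' \<le> HI m I f t"
    unfolding HI_def by (intro mult_left_mono nn_integral_mono mult_mono power_mono i) auto
qed

lemma KI_antimono: "antimono (KI m I f)"
proof (rule antimonoI)
  fix t t' :: real assume t: "t \<le> t'"
  have i: "indicator {t'<..<b} r \<le> (indicator {t<..<b} r :: ennreal)" for b r :: real
    using t by (auto simp: indicator_def)
  show "KI m I f t' \<le> KI m I f t"
    unfolding KI_def by (intro mult_left_mono nn_integral_mono i) auto
qed

section \<open>Upper and lower bounds for the two operators\<close>

locale weight =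
  fixes m :: nat and I :: "real \<Rightarrow> real" and c0 :: real
  assumes m: "m \<ge> 1"
    and I_pos: "\<And>t. 0 < t \<Longrightarrow> t \<le> 1 \<Longrightarrow> I t > 0"
    and I_mono: "\<And>s t. 0 < s \<Longrightarrow> s \<le> t \<Longrightarrow> t \<le> 1 \<Longrightarrow> I s \<le> I t"
    and c0: "0 < c0"
    and I_ge: "\<And>t. 0 < t \<Longrightarrow> t \<le> 1 \<Longrightarrow> c0 * t \<le> I t"
begin

lemma I_measurable:
  assumes [measurable]: "g \<in> borel_measurable lebesgue" and a: "0 \<le> t" "a \<le> 1"
  shows "(\<lambda>s. ennreal (g s / I s) * indicator {t<..<a} s) \<in> borel_measurable lebesgue"
proof -
  \<comment> \<open>\<open>I\<close> is monotone only on \<open>(0, 1]\<close>; this extension is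
    monotone on the whole line and agrees with \<open>I\<close> on the interval in question.\<close>
  define J where "J s = (if s \<le> 0 then 0 else if s \<le> 1 then I s else I 1)" for s
  have "mono J"
  proof (rule monoI)
    fix x y :: real assume "x \<le> y"
    then show "J x \<le> J y"
      using I_pos[of y] I_pos[of 1] I_mono[of x y] I_mono[of x 1] by (auto simp: J_def not_le intro: less_imp_le)
  qed
  then have [measurable]: "J \<in> borel_measurable lebesgue"
    using borel_measurable_mono by (simp add: measurable_completion)
  have "(\<lambda>s. ennreal (g s / I s) * indicator {t<..<a} s) = (\<lambda>s. ennreal (g s / J s) * indicator {t<..<a} s)"
    using a by (auto simp: fun_eq_iff indicator_def J_def)
  also have "\<dots> \<in> borel_measurable lebesgue" by measurable
  finally show ?thesis .
qed

lemma root_power_pred: "0 < s \<Longrightarrow> root m s ^ (m - 1) = s / root m s"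
proof -
  assume s: "0 < s"
  have "root m s * root m s ^ (m - 1) = root m s ^ m"
    using m by (simp add: power_Suc[symmetric] del: power_Suc)
  also have "\<dots> = s" using m s by simp
  finally show ?thesis using m s by (simp add: field_simps)
qed

text \<open>For \<open>r > t\<close> the hypothesis and the monotonicity of \<open>psi\<close> give
  \<open>1 / I r <= d * (root m r / r) / psi t\<close>, whose integral up to \<open>s\<close> is at
  most \<open>d * m * root m s / psi t\<close>. This is raised to the power \<open>m - 1\<close>,
  where \<open>root m s ^ (m - 1)\<close> equals \<open>s / root m s\<close>.\<close>

lemma HI_upper:
  assumes a: "0 < a" "a < 1" and d: "0 \<le> d"
    and psi: "\<And>t. 0 < t \<Longrightarrow> t < 1 \<Longrightarrow> 0 < psi t"
    and psi_mono: "\<And>s t. 0 < s \<Longrightarrow> s \<le> t \<Longrightarrow> t < 1 \<Longrightarrow> psi s \<le> psi t"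
    and bound: "\<And>r. 0 < r \<Longrightarrow> r < a \<Longrightarrow> 1 / I r \<le> d * (root m r / r) / psi r"
    and f[measurable]: "f \<in> borel_measurable lebesgue" and t: "0 < t" "t < 1"
  shows "HI m I (chi a f) t \<le> ennreal (1 / psi t ^ (m - 1)) *
    (\<integral>\<^sup>+ s. ennreal (real m ^ (m - 1) * d ^ (m - 1) * \<bar>f s\<bar> * (s / root m s) / I s) * indicator {t<..<a} s \<partial>lebesgue)"
proof -
  have inner: "(\<integral>\<^sup>+ r. ennreal (1 / I r) * indicator {t<..<s} r \<partial>lebesgue) \<le> ennreal (d / psi t * (real m * root m s))"
    if s: "t < s" "s < a" for s
  proof -
    note [measurable] = borel_measurable_root_lebesgue[OF m]
    have "(\<integral>\<^sup>+ r. ennreal (1 / I r) * indicator {t<..<s} r \<partial>lebesgue)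
        \<le> (\<integral>\<^sup>+ r. ennreal (d / psi t) * (ennreal (root m r / r) * indicator {t<..<s} r) \<partial>lebesgue)"
    proof (rule nn_integral_mono)
      fix r
      show "ennreal (1 / I r) * indicator {t<..<s} r \<le> ennreal (d / psi t) * (ennreal (root m r / r) * indicator {t<..<s} r)"
      proof (cases "r \<in> {t<..<s}")
        case True
        have "1 / I r \<le> d * (root m r / r) / psi r" using True s t by (intro bound) auto
        also have "\<dots> \<le> d * (root m r / r) / psi t"
          using True s t a d m psi[of t] psi[of r] psi_mono[of t r]
          by (intro divide_left_mono mult_nonneg_nonneg mult_pos_pos divide_nonneg_nonneg) auto
        finally have "ennreal (1 / I r) \<le> ennreal (d / psi t * (root m r / r))" by (intro ennreal_leI) (simp add: mult.commute)
        also have "\<dots> = ennreal (d / psi t) * ennreal (root m r / r)"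
          using True t d m psi[of t] by (intro ennreal_mult) auto
        finally show ?thesis using True by simp
      qed simp
    qed
    also have "\<dots> = ennreal (d / psi t) * (\<integral>\<^sup>+ r. ennreal (root m r / r) * indicator {t<..<s} r \<partial>lebesgue)"
      by (rule nn_integral_cmult) measurable
    also have "\<dots> \<le> ennreal (d / psi t) * ennreal (real m * root m s)"
      using m s t by (intro mult_left_mono nn_integral_root_le) auto
    also have "\<dots> = ennreal (d / psi t * (real m * root m s))"
      using d psi[OF t] s t by (intro ennreal_mult[symmetric] mult_nonneg_nonneg real_root_ge_zero) auto
    finally show ?thesis .
  qed
  let ?g = "\<lambda>s. ennreal (real m ^ (m - 1) * d ^ (m - 1) * \<bar>f s\<bar> * (s / root m s) / I s) * indicator {t<..<a} s"
  have g_meas: "?g \<in> borel_measurable lebesgue"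
  proof (rule I_measurable)
    note [measurable] = borel_measurable_root_lebesgue[OF m]
    show "(\<lambda>s. real m ^ (m - 1) * d ^ (m - 1) * \<bar>f s\<bar> * (s / root m s)) \<in> borel_measurable lebesgue"
      by measurable
  qed (use t a in auto)
  \<comment> \<open>The factor \<open>1 / fact (m - 1)\<close> is at most one and is given
    up.\<close>
  have "HI m I (chi a f) t \<le> 1 * (\<integral>\<^sup>+ s. ennreal (\<bar>chi a f s\<bar> / I s) *
        (\<integral>\<^sup>+ r. ennreal (1 / I r) * indicator {t<..<s} r \<partial>lebesgue) ^ (m - 1)
        * indicator {t<..<1} s \<partial>lebesgue)"
    unfolding HI_def by (rule mult_right_mono) auto
  also have "\<dots> \<le> (\<integral>\<^sup>+ s. ennreal (1 / psi t ^ (m - 1)) * ?g s \<partial>lebesgue)"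
    unfolding mult_1
  proof (rule nn_integral_mono)
    fix s
    show "ennreal (\<bar>chi a f s\<bar> / I s) * (\<integral>\<^sup>+ r. ennreal (1 / I r) * indicator {t<..<s} r \<partial>lebesgue) ^ (m - 1)
        * indicator {t<..<1} s \<le> ennreal (1 / psi t ^ (m - 1)) * ?g s"
    proof (cases "s \<in> {t<..<a}")
      case False
      then have "chi a f s = 0 \<or> s \<notin> {t<..<1}" using t by (auto simp: chi_def indicator_def)
      then show ?thesis by auto
    next
      case s: True
      have s0: "0 < s" using s t by auto
      have Is: "I s > 0" using s t a by (intro I_pos) auto
      have "ennreal (\<bar>chi a f s\<bar> / I s) * (\<integral>\<^sup>+ r. ennreal (1 / I r) * indicator {t<..<s} r \<partial>lebesgue) ^ (m - 1)
          \<le> ennreal (\<bar>f s\<bar> / I s) * ennreal (d / psi t * (real m * root m s)) ^ (m - 1)"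
        using s t inner[of s] by (intro mult_mono power_mono) (auto simp: chi_def)
      also have "\<dots> = ennreal (\<bar>f s\<bar> / I s * (d / psi t * (real m * root m s)) ^ (m - 1))"
        using d psi[OF t] s0 Is
        by (intro ennreal_mult_power mult_nonneg_nonneg divide_nonneg_nonneg real_root_ge_zero) auto
      also have "\<bar>f s\<bar> / I s * (d / psi t * (real m * root m s)) ^ (m - 1)
          = 1 / psi t ^ (m - 1) * (real m ^ (m - 1) * d ^ (m - 1) * \<bar>f s\<bar> * (s / root m s) / I s)"
        unfolding power_mult_distrib power_divide root_power_pred[OF s0] by (simp add: mult_ac)
      also have "ennreal \<dots> = ennreal (1 / psi t ^ (m - 1)) * ?g s"
        using d psi[OF t] s t Is m by (subst ennreal_mult) auto
      finally show ?thesis using s a by simp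
    qed
  qed
  also have "\<dots> = ennreal (1 / psi t ^ (m - 1)) * (\<integral>\<^sup>+ s. ?g s \<partial>lebesgue)"
    by (rule nn_integral_cmult[OF g_meas])
  finally show ?thesis .
qed

text \<open>The bound on \<open>1 / I\<close> is used pointwise at \<open>s\<close> in place of an
  inner integral: it gives \<open>s / I s <= d * root m s / psi t\<close>, to be raised to the power
  \<open>m - 1\<close>.\<close>

lemma KI_upper:
  assumes a: "0 < a" "a < 1" and d: "0 \<le> d"
    and psi: "\<And>t. 0 < t \<Longrightarrow> t < 1 \<Longrightarrow> 0 < psi t"
    and psi_mono: "\<And>s t. 0 < s \<Longrightarrow> s \<le> t \<Longrightarrow> t < 1 \<Longrightarrow> psi s \<le> psi t"
    and bound: "\<And>r. 0 < r \<Longrightarrow> r < a \<Longrightarrow> 1 / I r \<le> d * (root m r / r) / psi r"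
    and f[measurable]: "f \<in> borel_measurable lebesgue" and t: "0 < t" "t < 1"
  shows "KI m I (chi a f) t \<le> ennreal (1 / psi t ^ (m - 1)) *
    (\<integral>\<^sup>+ s. ennreal (real m ^ (m - 1) * d ^ (m - 1) * \<bar>f s\<bar> * (s / root m s) / I s) * indicator {t<..<a} s \<partial>lebesgue)"
proof -
  let ?g = "\<lambda>s. ennreal (real m ^ (m - 1) * d ^ (m - 1) * \<bar>f s\<bar> * (s / root m s) / I s) * indicator {t<..<a} s"
  have g_meas: "?g \<in> borel_measurable lebesgue"
  proof (rule I_measurable)
    note [measurable] = borel_measurable_root_lebesgue[OF m]
    show "(\<lambda>s. real m ^ (m - 1) * d ^ (m - 1) * \<bar>f s\<bar> * (s / root m s)) \<in> borel_measurable lebesgue"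
      by measurable
  qed (use t a in auto)
  have "KI m I (chi a f) t \<le> (\<integral>\<^sup>+ s. ennreal (1 / psi t ^ (m - 1)) * ?g s \<partial>lebesgue)"
    unfolding KI_def
  proof (rule nn_integral_mono)
    fix s
    show "ennreal (\<bar>chi a f s\<bar> * s ^ (m - 1) / I s ^ m) * indicator {t<..<1} s
        \<le> ennreal (1 / psi t ^ (m - 1)) * ?g s"
    proof (cases "s \<in> {t<..<a}")
      case False
      then have "chi a f s = 0 \<or> s \<notin> {t<..<1}" using t by (auto simp: chi_def indicator_def)
      then show ?thesis by auto
    next
      case s: True
      have s0: "0 < s" "s < 1" using s t a by auto
      have Is: "I s > 0" using s t a by (intro I_pos) auto
      have "s * (1 / I s) \<le> s * (d * (root m s / s) / psi s)"
        using s0 s by (intro mult_left_mono bound) auto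
      also have "\<dots> = d * root m s / psi s" using s0 by simp
      also have "\<dots> \<le> d * root m s / psi t"
        using s s0 t d m psi[of t] psi[of s] psi_mono[of t s]
        by (intro divide_left_mono mult_nonneg_nonneg mult_pos_pos) auto
      finally have q: "s / I s \<le> d * root m s / psi t" by simp
      have "I s ^ m = I s * I s ^ (m - 1)" using m by (simp add: power_Suc[symmetric] del: power_Suc)
      then have "\<bar>f s\<bar> * s ^ (m - 1) / I s ^ m = \<bar>f s\<bar> / I s * (s / I s) ^ (m - 1)"
        by (simp add: power_divide)
      also have "\<dots> \<le> \<bar>f s\<bar> / I s * (d * root m s / psi t) ^ (m - 1)"
        using q s0 Is by (intro mult_left_mono power_mono) auto
      also have "\<dots> = 1 * (\<bar>f s\<bar> / I s * (d * root m s / psi t) ^ (m - 1))" by simp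
      \<comment> \<open>The factor \<open>m ^ (m - 1)\<close>, at least one, is inserted to share
        the constant of \<open>HI_upper\<close>.\<close>
      also have "\<dots> \<le> real m ^ (m - 1) * (\<bar>f s\<bar> / I s * (d * root m s / psi t) ^ (m - 1))"
        using Is d m s0 psi[OF t] by (intro mult_right_mono one_le_power) auto
      also have "\<dots> = 1 / psi t ^ (m - 1) * (real m ^ (m - 1) * d ^ (m - 1) * \<bar>f s\<bar> * (s / root m s) / I s)"
        unfolding power_mult_distrib power_divide root_power_pred[OF s0(1)] by (simp add: mult_ac)
      finally have "ennreal (\<bar>f s\<bar> * s ^ (m - 1) / I s ^ m)
          \<le> ennreal (1 / psi t ^ (m - 1) * (real m ^ (m - 1) * d ^ (m - 1) * \<bar>f s\<bar> * (s / root m s) / I s))"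
        by (rule ennreal_leI)
      also have "\<dots> = ennreal (1 / psi t ^ (m - 1)) * ?g s"
        using d psi[OF t] s s0 Is m by (subst ennreal_mult) auto
      finally show ?thesis using s s0 a by (simp add: chi_def)
    qed
  qed
  also have "\<dots> = ennreal (1 / psi t ^ (m - 1)) * (\<integral>\<^sup>+ s. ?g s \<partial>lebesgue)"
    by (rule nn_integral_cmult[OF g_meas])
  finally show ?thesis .
qed

text \<open>For \<open>t < a / 4\<close> and \<open>s > a / 2\<close> the inner integral runs over a
  length of at least \<open>a / 4\<close>, on which \<open>1 / I r >= 1 / I a\<close>. The outer
  integral adds a factor \<open>g / I a\<close> and the length \<open>a / 2\<close>.\<close>

lemma HI_lower:
  assumes a: "0 < a" "a < 1" and g: "0 \<le> g" and t: "0 < t" "t < a / 4"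
  shows "ennreal (1 / (4 ^ m * fact (m - 1)) * g * a ^ m / I a ^ m)
    \<le> HI m I (chi a (\<lambda>s. g * indicator {a/2<..<a} s)) t"
proof -
  have Ia: "I a > 0" using a by (intro I_pos) auto
  define q where "q = g / I a * (a / 4 / I a) ^ (m - 1)"
  have q0: "0 \<le> q" using g Ia a by (auto simp: q_def)
  have Im: "I a ^ m = I a * I a ^ (m - 1)" "a ^ m = a * a ^ (m - 1)" "4 ^ m = 4 * (4::real) ^ (m - 1)"
    using m by (simp_all add: power_Suc[symmetric] del: power_Suc)
  have "1 / (4 ^ m * fact (m - 1)) * g * a ^ m / I a ^ m = 1 / fact (m - 1) * (q * (a / 4))"
    unfolding q_def Im by (simp add: power_divide mult_ac)
  \<comment> \<open>The outer length is \<open>a / 2\<close>; counting only \<open>a / 4\<close> of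
    it gives the constant its form \<open>4 ^ m\<close>.\<close>
  also have "\<dots> \<le> 1 / fact (m - 1) * (q * (a / 2))"
    using q0 a by (intro mult_left_mono) auto
  finally have "ennreal (1 / (4 ^ m * fact (m - 1)) * g * a ^ m / I a ^ m)
      \<le> ennreal (1 / fact (m - 1) * (q * (a / 2)))" by (rule ennreal_leI)
  also have "\<dots> = ennreal (1 / fact (m - 1)) * (ennreal q * ennreal (a / 2))"
    using q0 a by (subst ennreal_mult, simp, simp) (subst ennreal_mult, auto)
  also have "ennreal q * ennreal (a / 2) = (\<integral>\<^sup>+ s. ennreal q * indicator {a/2<..<a} s \<partial>lebesgue)"
    using a by (subst nn_integral_cmult_indicator) auto
  also have "ennreal (1 / fact (m - 1)) * \<dots> \<le> HI m I (chi a (\<lambda>s. g * indicator {a/2<..<a} s)) t"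
    unfolding HI_def
  proof (intro mult_left_mono nn_integral_mono)
    fix s
    let ?f = "chi a (\<lambda>s. g * indicator {a/2<..<a} s)"
    show "ennreal q * indicator {a/2<..<a} s \<le> ennreal (\<bar>?f s\<bar> / I s) *
        (\<integral>\<^sup>+ r. ennreal (1 / I r) * indicator {t<..<s} r \<partial>lebesgue) ^ (m - 1) * indicator {t<..<1} s"
    proof (cases "s \<in> {a/2<..<a}")
      case s: True
      have Is: "0 < I s" "I s \<le> I a" using s a by (auto intro!: I_pos I_mono)
      have "ennreal (a / 4 / I a) \<le> ennreal (1 / I a * (s - t))"
        using s t Ia by (intro ennreal_leI) (auto simp: field_simps)
      also have "\<dots> = ennreal (1 / I a) * ennreal (s - t)" using Ia s t by (intro ennreal_mult) auto
      also have "\<dots> = (\<integral>\<^sup>+ r. ennreal (1 / I a) * indicator {t<..<s} r \<partial>lebesgue)"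
        using s t by (subst nn_integral_cmult_indicator) auto
      also have "\<dots> \<le> (\<integral>\<^sup>+ r. ennreal (1 / I r) * indicator {t<..<s} r \<partial>lebesgue)"
      proof (rule nn_integral_mono)
        fix r
        show "ennreal (1 / I a) * indicator {t<..<s} r \<le> ennreal (1 / I r) * indicator {t<..<s} r"
          using s t a I_pos[of r] I_mono[of r a] Ia
          by (auto simp: indicator_def intro!: ennreal_leI divide_left_mono mult_pos_pos)
      qed
      finally have inner: "ennreal (a / 4 / I a) \<le> (\<integral>\<^sup>+ r. ennreal (1 / I r) * indicator {t<..<s} r \<partial>lebesgue)" .
      have "ennreal q = ennreal (g / I a) * ennreal (a / 4 / I a) ^ (m - 1)"
        unfolding q_def using Ia a g by (intro ennreal_mult_power[symmetric]) auto
      also have "\<dots> \<le> ennreal (g / I s) * (\<integral>\<^sup>+ r. ennreal (1 / I r) * indicator {t<..<s} r \<partial>lebesgue) ^ (m - 1)"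
        using inner Is g by (intro mult_mono power_mono ennreal_leI divide_left_mono mult_pos_pos) auto
      finally show ?thesis using s a t g by (simp add: chi_def)
    qed simp
  qed auto
  finally show ?thesis .
qed

text \<open>On \<open>(a / 2, a)\<close> the kernel is at least
  \<open>(a / 2) ^ (m - 1) / I a ^ m\<close>. Integration gives the factor \<open>1 / 2 ^ m\<close>,
  which is lowered to the constant of \<open>HI_lower\<close> so that both operators satisfy the
  same estimate.\<close>

lemma KI_lower:
  assumes a: "0 < a" "a < 1" and g: "0 \<le> g" and t: "0 < t" "t < a / 4"
  shows "ennreal (1 / (4 ^ m * fact (m - 1)) * g * a ^ m / I a ^ m)
    \<le> KI m I (chi a (\<lambda>s. g * indicator {a/2<..<a} s)) t"
proof -
  have Ia: "I a > 0" using a by (intro I_pos) auto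
  define q where "q = g * (a / 2) ^ (m - 1) / I a ^ m"
  have q0: "0 \<le> q" using g Ia a by (auto simp: q_def)
  have am: "a ^ m = a * a ^ (m - 1)" "2 ^ m = 2 * (2::real) ^ (m - 1)"
    using m by (simp_all add: power_Suc[symmetric] del: power_Suc)
  have "(2::real) ^ m * 1 \<le> 4 ^ m * fact (m - 1)"
    by (intro mult_mono power_mono) auto
  then have "1 / (4 ^ m * fact (m - 1)) \<le> 1 / (2::real) ^ m" by (simp add: frac_le)
  then have "1 / (4 ^ m * fact (m - 1)) * (g * a ^ m / I a ^ m) \<le> 1 / 2 ^ m * (g * a ^ m / I a ^ m)"
    using g a Ia by (intro mult_right_mono) auto
  also have "\<dots> = q * (a / 2)" unfolding q_def am by (simp add: power_divide mult_ac)
  finally have "ennreal (1 / (4 ^ m * fact (m - 1)) * g * a ^ m / I a ^ m) \<le> ennreal (q * (a / 2))"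
    by (intro ennreal_leI) simp
  also have "\<dots> = ennreal q * ennreal (a / 2)" using q0 a by (intro ennreal_mult) auto
  also have "\<dots> = (\<integral>\<^sup>+ s. ennreal q * indicator {a/2<..<a} s \<partial>lebesgue)"
    using a by (subst nn_integral_cmult_indicator) auto
  also have "\<dots> \<le> KI m I (chi a (\<lambda>s. g * indicator {a/2<..<a} s)) t"
    unfolding KI_def
  proof (rule nn_integral_mono)
    fix s
    let ?f = "chi a (\<lambda>s. g * indicator {a/2<..<a} s)"
    show "ennreal q * indicator {a/2<..<a} s \<le> ennreal (\<bar>?f s\<bar> * s ^ (m - 1) / I s ^ m) * indicator {t<..<1} s"
    proof (cases "s \<in> {a/2<..<a}")
      case s: True
      have Is: "0 < I s" "I s \<le> I a" using s a by (auto intro!: I_pos I_mono)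
      have "q \<le> g * s ^ (m - 1) / I s ^ m"
        unfolding q_def using s a g Is by (intro frac_le mult_left_mono power_mono) auto
      then show ?thesis using s a t g by (auto simp: chi_def intro!: ennreal_leI)
    qed simp
  qed
  finally show ?thesis .
qed

end

section \<open>Limits\<close>

lemma ennreal_pos_obtain_real:
  assumes "0 < (y::ennreal)"
  obtains e where "0 < e" "ennreal e < y"
proof (cases y)
  case (real r)
  with assms have "0 < r" by simp
  then show ?thesis using that[of "r / 2"] real by (simp add: ennreal_lessI)
next
  case top
  then show ?thesis using that[of 1] by simp
qed

lemma tendsto_0_ennrealI:
  fixes S :: "real \<Rightarrow> ennreal"
  assumes "\<And>e. 0 < e \<Longrightarrow> \<exists>b>0. \<forall>a. 0 < a \<longrightarrow> a < b \<longrightarrow> S a \<le> ennreal e"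
  shows "(S \<longlongrightarrow> 0) (at_right 0)"
proof (rule order_tendstoI)
  fix y :: ennreal assume "0 < y"
  then obtain e where e: "0 < e" "ennreal e < y" by (rule ennreal_pos_obtain_real)
  from assms[OF e(1)] obtain b where "b > 0" "\<And>a. 0 < a \<Longrightarrow> a < b \<Longrightarrow> S a \<le> ennreal e" by blast
  then show "eventually (\<lambda>a. S a < y) (at_right 0)"
    unfolding eventually_at_right_field using e(2) by (auto intro: le_less_trans)
qed simp

lemma tendsto_0_ennreal_le:
  fixes R S :: "real \<Rightarrow> ennreal"
  assumes S: "(S \<longlongrightarrow> 0) (at_right 0)" and le: "\<And>a. 0 < a \<Longrightarrow> a < 1 \<Longrightarrow> R a \<le> ennreal K * S a"
  shows "(R \<longlongrightarrow> 0) (at_right 0)"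
proof (rule tendsto_sandwich[OF _ _ tendsto_const])
  have "((\<lambda>a. ennreal K * S a) \<longlongrightarrow> ennreal K * 0) (at_right 0)"
    by (rule ennreal_tendsto_cmult[OF _ S]) simp
  then show "((\<lambda>a. ennreal K * S a) \<longlongrightarrow> 0) (at_right 0)" by simp
  show "eventually (\<lambda>a. R a \<le> ennreal K * S a) (at_right 0)"
    unfolding eventually_at_right_field using le by (intro exI[of _ 1]) auto
qed simp

lemma (in ri) fund_fun_quarter:
  assumes "0 < a" "a \<le> 1"
  shows "fund_fun X a \<le> 4 * fund_fun X (a / 4)"
proof -
  have "fund_fun X a \<le> 2 * fund_fun X (a / 2)" using assms by (rule fund_fun_half)
  also have "\<dots> \<le> 2 * (2 * fund_fun X (a / 2 / 2))"
    using assms by (intro mult_left_mono fund_fun_half) auto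
  also have "\<dots> = 4 * fund_fun X (a / 4)" by (simp add: mult.assoc[symmetric])
  finally show ?thesis .
qed

text \<open>The properties shared by \<open>HI\<close> and \<open>KI\<close>. The limit arguments
  use only these and are therefore carried out once, with \<open>C\<close> and \<open>c\<close>
  independent of \<open>a\<close>, \<open>f\<close> and \<open>psi\<close>.\<close>

locale kernel_op = weight +
  fixes T :: "(real \<Rightarrow> real) \<Rightarrow> real \<Rightarrow> ennreal" and C c :: real
  assumes T_antimono: "\<And>f. antimono (T f)"
    and T_upper: "\<And>a d psi f t. \<lbrakk>0 < a; a < 1; 0 \<le> d; \<And>t. 0 < t \<Longrightarrow> t < 1 \<Longrightarrow> 0 < psi t;
      \<And>s t. 0 < s \<Longrightarrow> s \<le> t \<Longrightarrow> t < 1 \<Longrightarrow> psi s \<le> psi t;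
      \<And>r. 0 < r \<Longrightarrow> r < a \<Longrightarrow> 1 / I r \<le> d * (root m r / r) / psi r;
      f \<in> borel_measurable lebesgue; 0 < t; t < 1\<rbrakk> \<Longrightarrow>
      T (chi a f) t \<le> ennreal (1 / psi t ^ (m - 1)) *
        (\<integral>\<^sup>+ s. ennreal (C * d ^ (m - 1) * \<bar>f s\<bar> * (s / root m s) / I s) * indicator {t<..<a} s \<partial>lebesgue)"
    and T_lower: "\<And>a g t. \<lbrakk>0 < a; a < 1; 0 \<le> g; 0 < t; t < a / 4\<rbrakk> \<Longrightarrow>
      ennreal (c * g * a ^ m / I a ^ m) \<le> T (chi a (\<lambda>s. g * indicator {a/2<..<a} s)) t"
    and C: "0 \<le> C" and c: "0 < c"
begin

lemma T_measurable[measurable]: "T f \<in> borel_measurable lebesgue"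
  using borel_measurable_antimono[OF T_antimono] by (simp add: measurable_completion)

text \<open>\<open>T_lower\<close> is a bound on \<open>(0, a / 4)\<close> only;
  \<open>fund_fun_quarter\<close> recovers the fundamental function at \<open>a\<close> at the cost
  of a factor \<open>4\<close>.\<close>

lemma norm_T_test_ge:
  assumes X: "ri_norm X" and a: "0 < a" "a < 1" and g: "0 \<le> g"
  shows "ennreal (c * g * a ^ m / I a ^ m) * fund_fun X a
    \<le> 4 * X (T (chi a (\<lambda>s. g * indicator {a/2<..<a} s)))"
proof -
  interpret ri X by (rule ri.intro[OF X])
  let ?q = "ennreal (c * g * a ^ m / I a ^ m)"
  have "?q * fund_fun X a \<le> ?q * (4 * fund_fun X (a / 4))"
    using a by (intro mult_left_mono fund_fun_quarter) auto
  also have "\<dots> = 4 * (?q * fund_fun X (a / 4))" by (simp add: mult_ac)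
  also have "?q * fund_fun X (a / 4) = X (\<lambda>t. ?q * indicator {0<..<a/4} t)"
    unfolding fund_fun_def by (rule cmult[symmetric]) auto
  also have "4 * \<dots> \<le> 4 * X (T (chi a (\<lambda>s. g * indicator {a/2<..<a} s)))"
  proof (intro mult_left_mono mono)
    fix t :: real
    show "?q * indicator {0<..<a/4} t \<le> T (chi a (\<lambda>s. g * indicator {a/2<..<a} s)) t"
      using T_lower[OF a g] by (auto simp: indicator_def)
  qed auto
  finally show ?thesis .
qed

text \<open>Necessity tests with a normalised indicator of \<open>(a / 2, a)\<close>. For
  sufficiency, \<open>psi\<close> is the \<open>m\<close>-th root of the fundamental function:
  smallness of \<open>?R\<close> becomes the hypothesis of \<open>T_upper\<close> with a small
  \<open>d\<close>, and \<open>level_bound\<close> turns the pointwise bound into a norm bound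
  proportional to \<open>d ^ m\<close>.\<close>

lemma norm_T_tendsto_iff:
  assumes X: "ri_norm X"
  shows "((\<lambda>a. SUP f \<in> {f \<in> borel_measurable lebesgue. L1norm (\<lambda>t. ennreal \<bar>f t\<bar>) \<le> 1}.
             X (T (chi a f))) \<longlongrightarrow> 0) (at_right 0)
     \<longleftrightarrow> ((\<lambda>a. ennreal (a ^ (m - 1) / (I a) ^ m) * fund_fun X a) \<longlongrightarrow> 0) (at_right 0)"
    (is "(?S \<longlongrightarrow> 0) _ \<longleftrightarrow> (?R \<longlongrightarrow> 0) _")
proof
  interpret ri X by (rule ri.intro[OF X])
  assume S: "(?S \<longlongrightarrow> 0) (at_right 0)"
  then show "(?R \<longlongrightarrow> 0) (at_right 0)"
  proof (rule tendsto_0_ennreal_le[where K = "2 / c"])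
    fix a :: real assume a: "0 < a" "a < 1"
    \<comment> \<open>Height \<open>2 / a\<close> gives unit \<open>L^1\<close> norm and makes the
      tested quantity \<open>2 * c\<close> times \<open>?R a\<close>; together with the factor
      \<open>4\<close> of \<open>norm_T_test_ge\<close> this accounts for
      \<open>2 / c\<close>.\<close>
    let ?f = "\<lambda>s. 2 / a * indicator {a/2<..<a} s :: real"
    have fm: "?f \<in> borel_measurable lebesgue"
      by (intro borel_measurable_times borel_measurable_const borel_measurable_indicator) simp
    have "L1norm (\<lambda>t. ennreal \<bar>?f t\<bar>) = (\<integral>\<^sup>+ t. ennreal (2 / a) * indicator {a/2<..<a} t \<partial>lebesgue)"
      unfolding L1norm_def using a by (intro nn_integral_cong) (auto simp: indicator_def)
    also have "\<dots> = ennreal (2 / a) * ennreal (a / 2)"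
      using a by (subst nn_integral_cmult_indicator) auto
    also have "\<dots> = 1" using a by (simp add: ennreal_mult[symmetric])
    finally have f1: "L1norm (\<lambda>t. ennreal \<bar>?f t\<bar>) = 1" .
    have Ia: "0 < I a" using a by (intro I_pos) auto
    have am: "a ^ m = a * a ^ (m - 1)" using m by (simp add: power_Suc[symmetric] del: power_Suc)
    have "?R a = ennreal (1 / (2 * c) * (c * (2 / a) * a ^ m / I a ^ m)) * fund_fun X a"
      unfolding am using a c by (simp add: field_simps)
    also have "\<dots> = ennreal (1 / (2 * c)) * (ennreal (c * (2 / a) * a ^ m / I a ^ m) * fund_fun X a)"
      using a c Ia by (subst ennreal_mult) (auto simp: mult.assoc)
    also have "\<dots> \<le> ennreal (1 / (2 * c)) * (4 * X (T (chi a ?f)))"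
      using a by (intro mult_left_mono norm_T_test_ge X) auto
    also have "X (T (chi a ?f)) \<le> ?S a"
      using fm f1 by (intro SUP_upper) auto
    also have "ennreal (1 / (2 * c)) * (4 * ?S a) = ennreal (2 / c) * ?S a"
    proof -
      have "ennreal (1 / (2 * c)) * 4 = ennreal (1 / (2 * c)) * ennreal 4" by simp
      also have "\<dots> = ennreal (2 / c)" using c by (subst ennreal_mult[symmetric]) (auto simp: field_simps)
      finally show ?thesis by (simp add: mult.assoc[symmetric])
    qed
    finally show "?R a \<le> ennreal (2 / c) * ?S a" by (simp add: mult_left_mono)
  qed
next
  interpret ri X by (rule ri.intro[OF X])
  assume R: "(?R \<longlongrightarrow> 0) (at_right 0)"
  define psi where "psi t = root m (enn2real (fund_fun X t))" for t
  have psi_phi: "fund_fun X t = ennreal (psi t ^ m)" for t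
    using fund_fun_finite[of t] m by (simp add: psi_def)
  have psi0: "0 < psi t" if "0 < t" for t
    using fund_fun_pos[OF that] fund_fun_finite[of t] m by (auto simp: psi_def enn2real_positive_iff)
  have psi_mono: "psi s \<le> psi t" if "s \<le> t" for s t
    using fund_fun_mono[OF that] fund_fun_finite[of t] m by (auto simp: psi_def enn2real_mono)
  show "(?S \<longlongrightarrow> 0) (at_right 0)"
  proof (rule tendsto_0_ennrealI)
    fix e :: real assume e: "0 < e"
    \<comment> \<open>\<open>2 ^ (m + 1)\<close> comes from \<open>level_bound\<close> and
      \<open>C\<close> from \<open>T_upper\<close>; the summand \<open>1\<close> keeps
      \<open>K\<close> positive even for \<open>C = 0\<close>.\<close>
    define K where "K = C * 2 ^ (m + 1) + 1"
    have K: "0 < K" using C by (auto simp: K_def intro: add_nonneg_pos)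
    define d where "d = root m (e / K)"
    have d0: "0 < d" and dm: "d ^ m = e / K" using m e K by (auto simp: d_def)
    have "eventually (\<lambda>a. ?R a < ennreal (d ^ m)) (at_right 0)"
      using d0 by (intro order_tendstoD(2)[OF R]) auto
    then obtain b where b: "b > 0" "\<And>r. 0 < r \<Longrightarrow> r < b \<Longrightarrow> ?R r < ennreal (d ^ m)"
      unfolding eventually_at_right_field by auto
    \<comment> \<open>Because \<open>root m r ^ m = r\<close>, the inequality
      \<open>?R r <= d ^ m\<close> is the \<open>m\<close>-th power of the claim,
      rearranged.\<close>
    have bound: "1 / I r \<le> d * (root m r / r) / psi r" if r: "0 < r" "r < b" "r < 1" for r
    proof -
      have Ir: "0 < I r" using r by (intro I_pos) auto
      have rt: "0 < root m r" "root m r ^ m = r" using m r by auto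
      have rm: "r ^ m = r * r ^ (m - 1)" using m by (simp add: power_Suc[symmetric] del: power_Suc)
      have "ennreal (r ^ (m - 1) / I r ^ m * psi r ^ m) = ?R r"
        using psi0[OF r(1)] r Ir by (subst ennreal_mult) (auto simp: psi_phi)
      also have "\<dots> \<le> ennreal (d ^ m)" using b(2)[of r] r by simp
      finally have "r ^ (m - 1) / I r ^ m * psi r ^ m \<le> d ^ m" using d0 by simp
      also have "r ^ (m - 1) / I r ^ m * psi r ^ m = (r * psi r / (root m r * I r)) ^ m"
        unfolding power_divide power_mult_distrib rt rm using r by simp
      finally have "(r * psi r / (root m r * I r)) ^ m \<le> d ^ m" .
      then have "r * psi r / (root m r * I r) \<le> d"
        using m d0 psi0[OF r(1)] r Ir rt by (subst (asm) power_mono_iff) auto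
      then show ?thesis using psi0[OF r(1)] r Ir rt by (simp add: field_simps)
    qed
    show "\<exists>b>0. \<forall>a. 0 < a \<longrightarrow> a < b \<longrightarrow> ?S a \<le> ennreal e"
    proof (intro exI[of _ "min b 1"] conjI allI impI)
      show "min b 1 > 0" using b by simp
      fix a :: real assume a: "0 < a" "a < min b 1"
      show "?S a \<le> ennreal e"
      proof (rule SUP_least)
        fix f assume "f \<in> {f \<in> borel_measurable lebesgue. L1norm (\<lambda>t. ennreal \<bar>f t\<bar>) \<le> 1}"
        then have f[measurable]: "f \<in> borel_measurable lebesgue" and f1: "L1norm (\<lambda>t. ennreal \<bar>f t\<bar>) \<le> 1" by auto
        \<comment> \<open>\<open>T_upper\<close> supplies \<open>d ^ (m - 1)\<close>; applying
          \<open>bound\<close> once more at \<open>s\<close> turns the weight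
          \<open>(s / root m s) / I s\<close> into at most \<open>d / psi s\<close> and supplies the
          last power.\<close>
        define h where "h s = ennreal (C * d ^ m) * ennreal \<bar>f s\<bar>" for s
        have hm[measurable]: "h \<in> borel_measurable lebesgue" unfolding h_def by measurable
        have "X (T (chi a f)) \<le> ennreal (2 ^ (m + 1)) * (\<integral>\<^sup>+ s. h s * indicator {0<..<a} s \<partial>lebesgue)"
        proof (rule level_bound[OF m _ _ psi0 psi_phi])
          fix t :: real assume t: "0 < t" "t < 1"
          have "T (chi a f) t \<le> ennreal (1 / psi t ^ (m - 1)) *
              (\<integral>\<^sup>+ s. ennreal (C * d ^ (m - 1) * \<bar>f s\<bar> * (s / root m s) / I s) * indicator {t<..<a} s \<partial>lebesgue)"
            using a d0 t psi0 psi_mono bound by (intro T_upper f) auto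
          also have "\<dots> \<le> ennreal (1 / psi t ^ (m - 1)) *
              (\<integral>\<^sup>+ s. h s * ennreal (1 / psi s) * indicator {t<..<a} s \<partial>lebesgue)"
          proof (intro mult_left_mono nn_integral_mono)
            fix s
            show "ennreal (C * d ^ (m - 1) * \<bar>f s\<bar> * (s / root m s) / I s) * indicator {t<..<a} s
                \<le> h s * ennreal (1 / psi s) * indicator {t<..<a} s"
            proof (cases "s \<in> {t<..<a}")
              case True
              then have s: "0 < s" "s < b" "s < 1" using t a by auto
              have rt: "0 < root m s" using m s by simp
              have "(s / root m s) * (1 / I s) \<le> (s / root m s) * (d * (root m s / s) / psi s)"
                using s rt by (intro mult_left_mono bound) auto
              also have "\<dots> = d / psi s" using s rt by simp
              finally have "C * d ^ (m - 1) * \<bar>f s\<bar> * ((s / root m s) * (1 / I s)) \<le> C * d ^ (m - 1) * \<bar>f s\<bar> * (d / psi s)"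
                using C d0 by (intro mult_left_mono) auto
              also have "\<dots> = C * d ^ m * \<bar>f s\<bar> * (1 / psi s)"
                using m by (cases m) auto
              finally have "ennreal (C * d ^ (m - 1) * \<bar>f s\<bar> * (s / root m s) / I s)
                  \<le> ennreal (C * d ^ m * \<bar>f s\<bar> * (1 / psi s))" by (intro ennreal_leI) simp
              also have "\<dots> = h s * ennreal (1 / psi s)"
                unfolding h_def using C d0 psi0[OF s(1)] by (subst ennreal_mult, simp, simp) (subst ennreal_mult, auto)
              finally show ?thesis using True by simp
            qed simp
          qed auto
          finally show "T (chi a f) t \<le> \<dots>" .
        qed (use a in auto)
        also have "(\<integral>\<^sup>+ s. h s * indicator {0<..<a} s \<partial>lebesgue)
            \<le> (\<integral>\<^sup>+ s. ennreal (C * d ^ m) * (ennreal \<bar>f s\<bar> * indicator {0<..<1} s) \<partial>lebesgue)"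
          using a by (intro nn_integral_mono) (auto simp: h_def indicator_def)
        also have "\<dots> = ennreal (C * d ^ m) * L1norm (\<lambda>t. ennreal \<bar>f t\<bar>)"
          unfolding L1norm_def by (rule nn_integral_cmult) measurable
        also have "\<dots> \<le> ennreal (C * d ^ m) * 1" using f1 by (intro mult_left_mono) auto
        finally have "X (T (chi a f)) \<le> ennreal (2 ^ (m + 1)) * ennreal (C * d ^ m)"
          by (simp add: mult_left_mono)
        also have "\<dots> = ennreal (2 ^ (m + 1) * (C * d ^ m))"
          using C d0 by (intro ennreal_mult[symmetric]) auto
        also have "\<dots> \<le> ennreal e"
        proof (rule ennreal_leI)
          have "2 ^ (m + 1) * (C * d ^ m) = (K - 1) / K * e" by (simp add: dm K_def)
          also have "\<dots> \<le> 1 * e" using K e by (intro mult_right_mono) auto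
          finally show "2 ^ (m + 1) * (C * d ^ m) \<le> e" by simp
        qed
        finally show "X (T (chi a f)) \<le> ennreal e" .
      qed
    qed
  qed
qed

text \<open>\<open>level_bound\<close> for \<open>L1norm\<close>, whose fundamental function is the
  identity on \<open>(0, 1)\<close>, so that \<open>psi = root m\<close>. The inequality
  \<open>c0 * r <= I r\<close> gives the hypothesis of \<open>T_upper\<close> with
  \<open>d = 1 / c0\<close>. In contrast to part (a), the weight \<open>s / I s\<close> is kept in
  the integral.\<close>

lemma L1norm_T_le:
  obtains K where "0 < K" "\<And>a f. 0 < a \<Longrightarrow> a < 1 \<Longrightarrow> f \<in> borel_measurable lebesgue \<Longrightarrow>
    L1norm (T (chi a f)) \<le> ennreal K * (\<integral>\<^sup>+ s. ennreal (\<bar>f s\<bar> * s / I s) * indicator {0<..<a} s \<partial>lebesgue)"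
proof -
  define D where "D = C * (1 / c0) ^ (m - 1)"
  have D0: "0 \<le> D" using C c0 by (simp add: D_def)
  define K where "K = 2 ^ (m + 1) * D + 1"
  have K: "0 < K" using D0 by (auto simp: K_def intro: add_nonneg_pos)
  have "L1norm (T (chi a f)) \<le> ennreal K * (\<integral>\<^sup>+ s. ennreal (\<bar>f s\<bar> * s / I s) * indicator {0<..<a} s \<partial>lebesgue)"
    if a: "0 < a" "a < 1" and f[measurable]: "f \<in> borel_measurable lebesgue" for a f
  proof -
    define h where "h s = ennreal D * (ennreal (\<bar>f s\<bar> * s / I s) * indicator {0<..<a} s)" for s
    have idm: "(\<lambda>s::real. s) \<in> borel_measurable lebesgue" by (intro measurable_completion) simp
    have fm: "(\<lambda>s. ennreal (\<bar>f s\<bar> * s / I s) * indicator {0<..<a} s) \<in> borel_measurable lebesgue"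
      using a idm by (intro I_measurable borel_measurable_times) auto
    then have hm: "h \<in> borel_measurable lebesgue" unfolding h_def by measurable
    have "L1norm (T (chi a f)) \<le> ennreal (2 ^ (m + 1)) * (\<integral>\<^sup>+ s. h s * indicator {0<..<a} s \<partial>lebesgue)"
    proof (rule L1.level_bound[OF m a, where psi = "root m"])
      show "0 < root m t" if "0 < t" for t using m that by simp
      show "fund_fun L1norm t = ennreal (root m t ^ m)" if "0 < t" "t < 1" for t
        using m that by (simp add: fund_fun_L1norm)
      fix t :: real assume t: "0 < t" "t < 1"
      have "T (chi a f) t \<le> ennreal (1 / root m t ^ (m - 1)) *
          (\<integral>\<^sup>+ s. ennreal (C * (1 / c0) ^ (m - 1) * \<bar>f s\<bar> * (s / root m s) / I s) * indicator {t<..<a} s \<partial>lebesgue)"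
      proof (rule T_upper[OF a])
        fix r assume r: "0 < r" "r < a"
        have "1 / I r \<le> 1 / (c0 * r)"
          using r a c0 I_pos[of r] I_ge[of r] by (intro divide_left_mono mult_pos_pos) auto
        also have "\<dots> = 1 / c0 * (root m r / r) / root m r" using m r by simp
        finally show "1 / I r \<le> 1 / c0 * (root m r / r) / root m r" .
      qed (use m t c0 in auto)
      also have "\<dots> \<le> ennreal (1 / root m t ^ (m - 1)) *
          (\<integral>\<^sup>+ s. h s * ennreal (1 / root m s) * indicator {t<..<a} s \<partial>lebesgue)"
      proof (intro mult_left_mono nn_integral_mono)
        fix s
        show "ennreal (C * (1 / c0) ^ (m - 1) * \<bar>f s\<bar> * (s / root m s) / I s) * indicator {t<..<a} s
            \<le> h s * ennreal (1 / root m s) * indicator {t<..<a} s"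
        proof (cases "s \<in> {t<..<a}")
          case True
          then have s: "0 < s" "s < a" "s < 1" using t a by auto
          have Is: "0 < I s" using s by (intro I_pos) auto
          have "C * (1 / c0) ^ (m - 1) * \<bar>f s\<bar> * (s / root m s) / I s = D * (\<bar>f s\<bar> * s / I s) * (1 / root m s)"
            by (simp add: D_def mult_ac)
          also have "ennreal \<dots> = ennreal D * ennreal (\<bar>f s\<bar> * s / I s) * ennreal (1 / root m s)"
            using D0 Is s m by (subst ennreal_mult, simp, simp) (subst ennreal_mult, auto)
          finally show ?thesis using True s by (simp add: h_def)
        qed simp
      qed auto
      finally show "T (chi a f) t \<le> \<dots>" .
    qed (use hm in auto)
    also have "(\<integral>\<^sup>+ s. h s * indicator {0<..<a} s \<partial>lebesgue)
        = (\<integral>\<^sup>+ s. ennreal D * (ennreal (\<bar>f s\<bar> * s / I s) * indicator {0<..<a} s) \<partial>lebesgue)"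
      by (intro nn_integral_cong) (auto simp: h_def indicator_def)
    also have "\<dots> = ennreal D * (\<integral>\<^sup>+ s. ennreal (\<bar>f s\<bar> * s / I s) * indicator {0<..<a} s \<partial>lebesgue)"
      by (rule nn_integral_cmult[OF fm])
    also have "ennreal (2 ^ (m + 1)) * \<dots> = ennreal (2 ^ (m + 1) * D) * (\<integral>\<^sup>+ s. ennreal (\<bar>f s\<bar> * s / I s) * indicator {0<..<a} s \<partial>lebesgue)"
      using D0 by (subst ennreal_mult) (auto simp: mult.assoc)
    also have "\<dots> \<le> ennreal K * (\<integral>\<^sup>+ s. ennreal (\<bar>f s\<bar> * s / I s) * indicator {0<..<a} s \<partial>lebesgue)"
      by (intro mult_right_mono ennreal_leI) (auto simp: K_def)
    finally show ?thesis .
  qed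
  with K show ?thesis by (rule that)
qed

text \<open>By \<open>L1norm_T_le\<close>, the limits in part (b) reduce to making one weighted
  integral uniformly small over the unit ball of \<open>X\<close>.\<close>

lemma L1norm_T_tendsto_if_integrals_small:
  assumes small: "\<And>e. 0 < e \<Longrightarrow> \<exists>b>0. \<forall>a f. 0 < a \<longrightarrow> a < b \<longrightarrow> f \<in> borel_measurable lebesgue \<longrightarrow> rnorm X f \<le> 1 \<longrightarrow>
      (\<integral>\<^sup>+ s. ennreal (\<bar>f s\<bar> * s / I s) * indicator {0<..<a} s \<partial>lebesgue) \<le> ennreal e"
  shows "((\<lambda>a. SUP f \<in> {f \<in> borel_measurable lebesgue. rnorm X f \<le> 1}.
             L1norm (T (chi a f))) \<longlongrightarrow> 0) (at_right 0)"
proof (rule tendsto_0_ennrealI)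
  fix e :: real assume e: "0 < e"
  obtain K where K: "0 < K" "\<And>a f. 0 < a \<Longrightarrow> a < 1 \<Longrightarrow> f \<in> borel_measurable lebesgue \<Longrightarrow>
    L1norm (T (chi a f)) \<le> ennreal K * (\<integral>\<^sup>+ s. ennreal (\<bar>f s\<bar> * s / I s) * indicator {0<..<a} s \<partial>lebesgue)"
    using L1norm_T_le by blast
  from small[of "e / K"] e K(1) obtain b where b: "b > 0"
    "\<And>a f. 0 < a \<Longrightarrow> a < b \<Longrightarrow> f \<in> borel_measurable lebesgue \<Longrightarrow> rnorm X f \<le> 1 \<Longrightarrow>
      (\<integral>\<^sup>+ s. ennreal (\<bar>f s\<bar> * s / I s) * indicator {0<..<a} s \<partial>lebesgue) \<le> ennreal (e / K)"
    by auto
  show "\<exists>b>0. \<forall>a. 0 < a \<longrightarrow> a < b \<longrightarrow> (SUP f \<in> {f \<in> borel_measurable lebesgue. rnorm X f \<le> 1}.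
             L1norm (T (chi a f))) \<le> ennreal e"
  proof (intro exI[of _ "min b 1"] conjI allI impI SUP_least)
    show "min b 1 > 0" using b by simp
    fix a f assume a: "0 < a" "a < min b 1" and f: "f \<in> {f \<in> borel_measurable lebesgue. rnorm X f \<le> 1}"
    have "L1norm (T (chi a f)) \<le> ennreal K * (\<integral>\<^sup>+ s. ennreal (\<bar>f s\<bar> * s / I s) * indicator {0<..<a} s \<partial>lebesgue)"
      using a f by (intro K) auto
    also have "\<dots> \<le> ennreal K * ennreal (e / K)" using a f by (intro mult_left_mono b) auto
    also have "\<dots> = ennreal e" using K e by (simp add: ennreal_mult[symmetric])
    finally show "L1norm (T (chi a f)) \<le> ennreal e" .
  qed
qed

text \<open>When the spaces differ, the fundamental function is not \<open>O(a)\<close>, so some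
  \<open>b\<close> has \<open>fund_fun X b > N * b\<close>. By \<open>integral_initial_le\<close>,
  functions in the unit ball then have integral at most \<open>1 / N\<close> over
  \<open>(0, b)\<close>, and the weight \<open>s / I s\<close> is at most \<open>1 / c0\<close>. A
  single \<open>b\<close> serves all \<open>a < b\<close>.\<close>

lemma L1norm_T_tendsto_if_Xspace_neq_L1space:
  assumes X: "ri_norm X" and ne: "Xspace X \<noteq> L1space"
  shows "((\<lambda>a. SUP f \<in> {f \<in> borel_measurable lebesgue. rnorm X f \<le> 1}.
             L1norm (T (chi a f))) \<longlongrightarrow> 0) (at_right 0)"
proof (rule L1norm_T_tendsto_if_integrals_small)
  interpret ri X by (rule ri.intro[OF X])
  fix e :: real assume e: "0 < e"
  \<comment> \<open>Chosen so that \<open>1 / (c0 * N) = e\<close>.\<close>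
  define N where "N = 1 / (c0 * e)"
  have N: "0 < N" using c0 e by (simp add: N_def)
  have "\<exists>b. 0 < b \<and> b < 1 \<and> ennreal (N * b) < fund_fun X b"
  proof (rule ccontr)
    assume "\<not> ?thesis"
    then have "\<And>b. 0 < b \<Longrightarrow> b < 1 \<Longrightarrow> fund_fun X b \<le> ennreal (N * b)" by (meson not_le)
    then show False using Xspace_eq_L1space_if_fund_fun_le[of N] ne N by simp
  qed
  then obtain b where b: "0 < b" "b < 1" "ennreal (N * b) < fund_fun X b" by blast
  show "\<exists>b>0. \<forall>a f. 0 < a \<longrightarrow> a < b \<longrightarrow> f \<in> borel_measurable lebesgue \<longrightarrow> rnorm X f \<le> 1 \<longrightarrow>
      (\<integral>\<^sup>+ s. ennreal (\<bar>f s\<bar> * s / I s) * indicator {0<..<a} s \<partial>lebesgue) \<le> ennreal e"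
  proof (intro exI[of _ b] conjI allI impI)
    fix a f assume a: "0 < a" "a < b" and f[measurable]: "f \<in> borel_measurable lebesgue" and f1: "rnorm X f \<le> 1"
    define v where "v = (\<integral>\<^sup>+ s. ennreal \<bar>f s\<bar> * indicator {0<..<b} s \<partial>lebesgue)"
    have "v * ennreal (N * b) \<le> v * fund_fun X b" using b by (intro mult_left_mono) auto
    also have "\<dots> \<le> ennreal b"
      unfolding v_def using b f1 by (intro integral_initial_le) (auto simp: rnorm_def)
    finally have vb: "v * ennreal (N * b) \<le> ennreal b" .
    have v: "v \<le> ennreal (1 / N)"
    proof -
      have "v = v * ennreal (N * b) * ennreal (1 / (N * b))"
        using N b by (simp add: mult.assoc ennreal_mult[symmetric])
      also have "\<dots> \<le> ennreal b * ennreal (1 / (N * b))" by (intro mult_right_mono vb) auto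
      also have "\<dots> = ennreal (1 / N)" using N b by (simp add: ennreal_mult[symmetric])
      finally show ?thesis .
    qed
    have "(\<integral>\<^sup>+ s. ennreal (\<bar>f s\<bar> * s / I s) * indicator {0<..<a} s \<partial>lebesgue)
        \<le> (\<integral>\<^sup>+ s. ennreal (1 / c0) * (ennreal \<bar>f s\<bar> * indicator {0<..<b} s) \<partial>lebesgue)"
    proof (rule nn_integral_mono)
      fix s
      show "ennreal (\<bar>f s\<bar> * s / I s) * indicator {0<..<a} s
          \<le> ennreal (1 / c0) * (ennreal \<bar>f s\<bar> * indicator {0<..<b} s)"
      proof (cases "s \<in> {0<..<a}")
        case True
        then have s: "0 < s" "s < b" "s < 1" using a b by auto
        have "s / I s \<le> 1 / c0" using s I_pos[of s] I_ge[of s] c0 by (simp add: field_simps)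
        then have "\<bar>f s\<bar> * (s / I s) \<le> \<bar>f s\<bar> * (1 / c0)" by (intro mult_left_mono) auto
        then have "ennreal (\<bar>f s\<bar> * s / I s) \<le> ennreal (1 / c0 * \<bar>f s\<bar>)" by (intro ennreal_leI) simp
        also have "\<dots> = ennreal (1 / c0) * ennreal \<bar>f s\<bar>" using c0 by (intro ennreal_mult) auto
        finally show ?thesis using True s by simp
      qed simp
    qed
    also have "\<dots> = ennreal (1 / c0) * v" unfolding v_def by (rule nn_integral_cmult) measurable
    also have "\<dots> \<le> ennreal (1 / c0) * ennreal (1 / N)" by (intro mult_left_mono v) auto
    also have "\<dots> = ennreal e" using c0 N e by (simp add: ennreal_mult[symmetric] N_def)
    finally show "(\<integral>\<^sup>+ s. ennreal (\<bar>f s\<bar> * s / I s) * indicator {0<..<a} s \<partial>lebesgue) \<le> ennreal e" .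
  qed (rule b)
qed

text \<open>Equality of the spaces gives \<open>fund_fun X a <= D * a\<close>, which normalises the
  test functions for necessity. Conversely, the embedding bounds the \<open>L^1\<close> norm on the
  unit ball, so a small weight \<open>s / I s\<close> makes the integrals small.\<close>

lemma L1norm_T_tendsto_iff_if_Xspace_eq_L1space:
  assumes X: "ri_norm X" and eq: "Xspace X = L1space"
  shows "((\<lambda>a. SUP f \<in> {f \<in> borel_measurable lebesgue. rnorm X f \<le> 1}.
             L1norm (T (chi a f))) \<longlongrightarrow> 0) (at_right 0)
     \<longleftrightarrow> ((\<lambda>s. s / I s) \<longlongrightarrow> 0) (at_right 0)" (is "(?S \<longlongrightarrow> 0) _ \<longleftrightarrow> _")
proof
  interpret ri X by (rule ri.intro[OF X])
  assume S: "(?S \<longlongrightarrow> 0) (at_right 0)"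
  obtain D where D: "0 < D" "\<And>a. 0 < a \<Longrightarrow> a < 1 \<Longrightarrow> fund_fun X a \<le> ennreal (D * a)"
    using fund_fun_le_if_Xspace_eq_L1space[OF eq] by blast
  have "((\<lambda>a. ennreal ((a / I a) ^ m)) \<longlongrightarrow> 0) (at_right 0)"
  proof (rule tendsto_0_ennreal_le[OF S, where K = "4 * D / c"])
    fix a :: real assume a: "0 < a" "a < 1"
    \<comment> \<open>Height \<open>1 / (D * a)\<close> puts the function in the unit ball of
      \<open>X\<close>, while the lower bound in \<open>L^1\<close> has the size of
      \<open>(a / I a) ^ m\<close>.\<close>
    let ?f = "\<lambda>s. 1 / (D * a) * indicator {a/2<..<a} s :: real"
    have fm: "?f \<in> borel_measurable lebesgue"
      by (intro borel_measurable_times borel_measurable_const borel_measurable_indicator) simp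
    have "rnorm X ?f \<le> X (\<lambda>t. ennreal (1 / (D * a)) * indicator {0<..<a} t)"
      unfolding rnorm_def
    proof (rule mono)
      show "(\<lambda>t. ennreal \<bar>?f t\<bar>) \<in> borel_measurable lebesgue" using fm by measurable
      show "ennreal \<bar>?f t\<bar> \<le> ennreal (1 / (D * a)) * indicator {0<..<a} t" for t
        using a D by (auto simp: indicator_def)
    qed measurable
    also have "\<dots> = ennreal (1 / (D * a)) * fund_fun X a"
      unfolding fund_fun_def by (rule cmult) auto
    also have "\<dots> \<le> ennreal (1 / (D * a)) * ennreal (D * a)" using a by (intro mult_left_mono D) auto
    also have "\<dots> = 1" using a D by (simp add: ennreal_mult[symmetric])
    finally have f1: "rnorm X ?f \<le> 1" .
    have Ia: "0 < I a" using a by (intro I_pos) auto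
    have "ennreal ((a / I a) ^ m) = ennreal (D / c * (c * (1 / (D * a)) * a ^ m / I a ^ m * a))"
      using a c D by (simp add: power_divide)
    also have "\<dots> = ennreal (D / c) * (ennreal (c * (1 / (D * a)) * a ^ m / I a ^ m) * ennreal a)"
      using a c D Ia by (subst ennreal_mult, simp, simp) (subst ennreal_mult, auto)
    also have "\<dots> = ennreal (D / c) * (ennreal (c * (1 / (D * a)) * a ^ m / I a ^ m) * fund_fun L1norm a)"
      using a by (simp add: fund_fun_L1norm)
    also have "\<dots> \<le> ennreal (D / c) * (4 * L1norm (T (chi a ?f)))"
      using a D by (intro mult_left_mono norm_T_test_ge ri_norm_L1norm) auto
    also have "\<dots> \<le> ennreal (D / c) * (4 * ?S a)"
      using fm f1 by (intro mult_left_mono SUP_upper) auto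
    also have "\<dots> = ennreal (4 * D / c) * ?S a"
    proof -
      have "ennreal (D / c) * 4 = ennreal (D / c) * ennreal 4" by simp
      also have "\<dots> = ennreal (4 * D / c)" using c D by (subst ennreal_mult[symmetric]) (auto simp: field_simps)
      finally show ?thesis by (simp add: mult.assoc[symmetric])
    qed
    finally show "ennreal ((a / I a) ^ m) \<le> ennreal (4 * D / c) * ?S a" .
  qed
  \<comment> \<open>The limit is freed first from \<open>ennreal\<close>, then from the
    \<open>m\<close>-th power by continuity of the root.\<close>
  then have "((\<lambda>a. ennreal ((a / I a) ^ m)) \<longlongrightarrow> ennreal 0) (at_right 0)" by simp
  moreover have ev: "eventually (\<lambda>a. 0 < a / I a) (at_right 0)"
    unfolding eventually_at_right_field using I_pos by (intro exI[of _ 1]) auto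
  then have "eventually (\<lambda>a. 0 \<le> (a / I a) ^ m) (at_right 0)"
    by eventually_elim auto
  ultimately have "((\<lambda>a. (a / I a) ^ m) \<longlongrightarrow> 0) (at_right 0)"
    by (subst (asm) tendsto_ennreal_iff) auto
  then have "((\<lambda>a. root m ((a / I a) ^ m)) \<longlongrightarrow> root m 0) (at_right 0)"
    by (rule tendsto_real_root)
  moreover have "eventually (\<lambda>a. root m ((a / I a) ^ m) = a / I a) (at_right 0)"
    using ev by eventually_elim (use m in \<open>auto intro!: real_root_power_cancel\<close>)
  ultimately show "((\<lambda>s. s / I s) \<longlongrightarrow> 0) (at_right 0)"
    by (simp add: filterlim_cong)
next
  interpret ri X by (rule ri.intro[OF X])
  assume lim: "((\<lambda>s. s / I s) \<longlongrightarrow> 0) (at_right 0)"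
  obtain D where D: "0 < D" "\<And>f. f \<in> borel_measurable lebesgue \<Longrightarrow> L1norm f \<le> ennreal D * X f"
    using L1norm_le by blast
  show "(?S \<longlongrightarrow> 0) (at_right 0)"
  proof (rule L1norm_T_tendsto_if_integrals_small)
    fix e :: real assume e: "0 < e"
    \<comment> \<open>With the weight below \<open>e / D\<close>, the constant \<open>D\<close> of
      the embedding into \<open>L^1\<close> cancels.\<close>
    have "eventually (\<lambda>s. s / I s < e / D) (at_right 0)"
      using e D by (intro order_tendstoD(2)[OF lim]) auto
    then obtain b where b: "b > 0" "\<And>s. 0 < s \<Longrightarrow> s < b \<Longrightarrow> s / I s < e / D"
      unfolding eventually_at_right_field by auto
    show "\<exists>b>0. \<forall>a f. 0 < a \<longrightarrow> a < b \<longrightarrow> f \<in> borel_measurable lebesgue \<longrightarrow> rnorm X f \<le> 1 \<longrightarrow>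
      (\<integral>\<^sup>+ s. ennreal (\<bar>f s\<bar> * s / I s) * indicator {0<..<a} s \<partial>lebesgue) \<le> ennreal e"
    proof (intro exI[of _ "min b 1"] conjI allI impI)
      show "min b 1 > 0" using b by simp
      fix a f assume a: "0 < a" "a < min b 1" and f[measurable]: "f \<in> borel_measurable lebesgue" and f1: "rnorm X f \<le> 1"
      have "(\<integral>\<^sup>+ s. ennreal (\<bar>f s\<bar> * s / I s) * indicator {0<..<a} s \<partial>lebesgue)
          \<le> (\<integral>\<^sup>+ s. ennreal (e / D) * (ennreal \<bar>f s\<bar> * indicator {0<..<1} s) \<partial>lebesgue)"
      proof (rule nn_integral_mono)
        fix s
        show "ennreal (\<bar>f s\<bar> * s / I s) * indicator {0<..<a} s
            \<le> ennreal (e / D) * (ennreal \<bar>f s\<bar> * indicator {0<..<1} s)"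
        proof (cases "s \<in> {0<..<a}")
          case True
          then have s: "0 < s" "s < b" "s < 1" using a by auto
          have "\<bar>f s\<bar> * (s / I s) \<le> \<bar>f s\<bar> * (e / D)"
            using b(2)[OF s(1,2)] by (intro mult_left_mono) auto
          then have "ennreal (\<bar>f s\<bar> * s / I s) \<le> ennreal (e / D * \<bar>f s\<bar>)" by (intro ennreal_leI) (simp add: mult.commute)
          also have "\<dots> = ennreal (e / D) * ennreal \<bar>f s\<bar>" using e D by (intro ennreal_mult) auto
          finally show ?thesis using True s by simp
        qed simp
      qed
      also have "\<dots> = ennreal (e / D) * L1norm (\<lambda>s. ennreal \<bar>f s\<bar>)"
        unfolding L1norm_def by (rule nn_integral_cmult) measurable
      also have "\<dots> \<le> ennreal (e / D) * (ennreal D * X (\<lambda>s. ennreal \<bar>f s\<bar>))"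
        by (intro mult_left_mono D) auto
      also have "\<dots> \<le> ennreal (e / D) * (ennreal D * 1)"
        using f1 by (intro mult_left_mono) (auto simp: rnorm_def)
      also have "\<dots> = ennreal e" using e D by (simp add: ennreal_mult[symmetric])
      finally show "(\<integral>\<^sup>+ s. ennreal (\<bar>f s\<bar> * s / I s) * indicator {0<..<a} s \<partial>lebesgue) \<le> ennreal e" .
    qed
  qed
qed

end

section \<open>Assembling (a) and (b) for the two operators\<close>

theorem theorem7p1:
  fixes m :: nat and I :: "real \<Rightarrow> real" and X :: "(real \<Rightarrow> ennreal) \<Rightarrow> ennreal"
  assumes m: "m \<ge> 1"
    and I_pos: "\<forall>t \<in> {0<..1}. I t > 0"
    and I_mono: "mono_on {0<..1} I"
    and I_inf: "Inf ((\<lambda>t. I t / t) ` {0<..1}) > 0"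
    and X: "ri_norm X"
  shows
   "((((\<lambda>a. SUP f \<in> {f \<in> borel_measurable lebesgue. L1norm (\<lambda>t. ennreal \<bar>f t\<bar>) \<le> 1}.
             X (HI m I (chi a f))) \<longlongrightarrow> 0) (at_right 0))
     \<longleftrightarrow> (((\<lambda>a. SUP f \<in> {f \<in> borel_measurable lebesgue. L1norm (\<lambda>t. ennreal \<bar>f t\<bar>) \<le> 1}.
             X (KI m I (chi a f))) \<longlongrightarrow> 0) (at_right 0)))
    \<and> ((((\<lambda>a. SUP f \<in> {f \<in> borel_measurable lebesgue. L1norm (\<lambda>t. ennreal \<bar>f t\<bar>) \<le> 1}.
             X (KI m I (chi a f))) \<longlongrightarrow> 0) (at_right 0))
     \<longleftrightarrow> (((\<lambda>a. ennreal (a ^ (m - 1) / (I a) ^ m) * fund_fun X a) \<longlongrightarrow> 0) (at_right 0)))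
    \<and> ((((\<lambda>a. SUP f \<in> {f \<in> borel_measurable lebesgue. rnorm X f \<le> 1}.
             L1norm (HI m I (chi a f))) \<longlongrightarrow> 0) (at_right 0))
     \<longleftrightarrow> (((\<lambda>a. SUP f \<in> {f \<in> borel_measurable lebesgue. rnorm X f \<le> 1}.
             L1norm (KI m I (chi a f))) \<longlongrightarrow> 0) (at_right 0)))
    \<and> (Xspace X \<noteq> L1space \<longrightarrow>
         (((\<lambda>a. SUP f \<in> {f \<in> borel_measurable lebesgue. rnorm X f \<le> 1}.
             L1norm (HI m I (chi a f))) \<longlongrightarrow> 0) (at_right 0))
       \<and> (((\<lambda>a. SUP f \<in> {f \<in> borel_measurable lebesgue. rnorm X f \<le> 1}.
             L1norm (KI m I (chi a f))) \<longlongrightarrow> 0) (at_right 0)))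
    \<and> (Xspace X = L1space \<longrightarrow>
         ((((\<lambda>a. SUP f \<in> {f \<in> borel_measurable lebesgue. rnorm X f \<le> 1}.
             L1norm (HI m I (chi a f))) \<longlongrightarrow> 0) (at_right 0))
          \<longleftrightarrow> ((\<lambda>s. s / I s) \<longlongrightarrow> 0) (at_right 0))
       \<and> ((((\<lambda>a. SUP f \<in> {f \<in> borel_measurable lebesgue. rnorm X f \<le> 1}.
             L1norm (KI m I (chi a f))) \<longlongrightarrow> 0) (at_right 0))
          \<longleftrightarrow> ((\<lambda>s. s / I s) \<longlongrightarrow> 0) (at_right 0)))"
proof -
  define c0 where "c0 = Inf ((\<lambda>t. I t / t) ` {0<..1})"
  \<comment> \<open>Positivity of the quotients bounds the set below, so that \<open>Inf\<close> is
    a genuine lower bound and \<open>c0 * t <= I t\<close> follows.\<close>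
  have bdd: "bdd_below ((\<lambda>t. I t / t) ` {0<..1})"
    using I_pos by (intro bdd_belowI[of _ 0]) (auto intro!: less_imp_le)
  interpret weight m I c0
  proof
    fix t :: real assume t: "0 < t" "t \<le> 1"
    then show "0 < I t" using I_pos by auto
    have "c0 \<le> I t / t" unfolding c0_def using t by (intro cInf_lower bdd) auto
    then show "c0 * t \<le> I t" using t by (simp add: field_simps)
  next
    fix s t :: real assume "0 < s" "s \<le> t" "t \<le> 1"
    then show "I s \<le> I t" by (intro mono_onD[OF I_mono]) auto
  qed (use m I_inf in \<open>auto simp: c0_def\<close>)
  interpret H: kernel_op m I c0 "HI m I" "real m ^ (m - 1)" "1 / (4 ^ m * fact (m - 1))"
    by unfold_locales (rule HI_antimono HI_upper HI_lower; assumption | simp)+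
  interpret K: kernel_op m I c0 "KI m I" "real m ^ (m - 1)" "1 / (4 ^ m * fact (m - 1))"
    by unfold_locales (rule KI_antimono KI_upper KI_lower; assumption | simp)+
  show ?thesis
  \<comment> \<open>The equivalence in (b) comes out of this distinction: either both limits are
    equivalent to \<open>s / I s\<close> tending to \<open>0\<close>, or both hold.\<close>
  proof (cases "Xspace X = L1space")
    case True
    show ?thesis
      using True by (simp only: H.norm_T_tendsto_iff[OF X] K.norm_T_tendsto_iff[OF X]
          H.L1norm_T_tendsto_iff_if_Xspace_eq_L1space[OF X True]
          K.L1norm_T_tendsto_iff_if_Xspace_eq_L1space[OF X True]) simp
  next
    case False
    show ?thesis
      using False H.L1norm_T_tendsto_if_Xspace_neq_L1space[OF X False]
        K.L1norm_T_tendsto_if_Xspace_neq_L1space[OF X False]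
      by (simp only: H.norm_T_tendsto_iff[OF X] K.norm_T_tendsto_iff[OF X]) simp
  qed
qed

end
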